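(* Let $q$ be an odd prime power. Fix characters $\omega\colon\mathbb F_q^\times\to\mathbb C^\times$ and $\psi\colon\mathbb F_q\to\mathbb C^\times$ and some $T\in\operatorname{Sym}_n^\times$, and set $$g_n(\omega,\psi,T)=\sum_{A\in\operatorname{Sym}_n^\times}\omega(\det A)\psi(\operatorname{tr}AT).$$ Let $\chi\colon\mathbb F_q^\times\to\mathbb C^\times$ denote the nontrivial quadratic character. (a) Suppose $\psi\ne1$. If $n=2m$ is a positive even integer, then $$g_{2m}(\omega,\psi,T)=\frac{\chi(-1)^m\chi(\det T)q^{m^2}}{\omega(4^m\det T)}\cdot g(\omega^2,\psi)^m.$$ If $n=2m+1$ is an odd nonnegative integer, then $$g_{2m+1}(\omega,\psi,T)=\frac{q^{m(m+1)}}{\omega(4^m\det T)}\cdot g(\omega,\psi)\,g(\omega^2,\psi)^m.$$ (b) Suppose $\psi=1$ and $\omega=\chi$. If $n=2m$ is even, then $$g_{2m}(\chi,1,T)=\chi(-1)^mq^{m^2}\prod_{k=0}^{m-1}\left(q^{2k+1}-1\right).$$ (c) Suppose $\psi=1$ and $\omega=1$. If $n=2m$ is even, then $$g_{2m}(1,1,T)=q^{m^2+m}\prod_{k=0}^{m-1}\left(q^{2k+1}-1\right).$$ If $n=2m+1$ is odd, then $$g_{2m+1}(1,1,T)=q^{m^2+m}\prod_{k=0}^{m}\left(q^{2k+1}-1\right).$$ (d) If $\psi=1$ and either $\omega\notin\{1,\chi\}$, or $\omega=\chi$ and $n$ is odd, then the sum $g_n(\omega,\psi,T)$ vanishes when $n$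 is positive.
   Context: $\operatorname{Sym}_n^\times$ is the set of invertible symmetric $n\times n$ matrices over $\mathbb F_q$. $g(\omega,\psi)=\sum_{a\in\mathbb F_q^\times}\omega(a)\psi(a)$ is the usual Gauss sum. *)

theory Defs
  imports Complex_Main "HOL-Library.Cardinality" "Jordan_Normal_Form.Determinant"
begin

(* A character of the unit group of the field is represented by its extension by zero to the
   whole field. This normalisation makes equality of the HOL functions coincide with
   equality of characters; every homomorphism from the unit group to the nonzero complex
   numbers has exactly one such extension. *)
definition mult_character :: "('a::field \<Rightarrow> complex) \<Rightarrow> bool" where
  "mult_character \<omega> \<longleftrightarrow>
     \<omega> 0 = 0 \<and>
     (\<forall>a. a \<noteq> 0 \<longrightarrow> \<omega> a \<noteq> 0) \<and>
     (\<forall>a b. a \<noteq> 0 \<longrightarrow> b \<noteq> 0 \<longrightarrow> \<omega> (a * b) = \<omega> a * \<omega> b)"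

definition trivial_mult_character :: "'a::field \<Rightarrow> complex" where
  "trivial_mult_character a = (if a = 0 then 0 else 1)"

definition add_character :: "('a::field \<Rightarrow> complex) \<Rightarrow> bool" where
  "add_character \<psi> \<longleftrightarrow> (\<forall>a. \<psi> a \<noteq> 0) \<and> (\<forall>a b. \<psi> (a + b) = \<psi> a * \<psi> b)"

definition trivial_add_character :: "'a::field \<Rightarrow> complex" where
  "trivial_add_character a = 1"

(* Over a finite field of odd order exactly one function satisfies this predicate. *)
definition nontrivial_quadratic_character :: "('a::field \<Rightarrow> complex) \<Rightarrow> bool" where
  "nontrivial_quadratic_character \<chi> \<longleftrightarrow>
     mult_character \<chi> \<and> \<chi> \<noteq> trivial_mult_character \<and>
     (\<lambda>a. \<chi> a ^ 2) = trivial_mult_character"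

definition gauss_sum :: "('a::{field,finite} \<Rightarrow> complex) \<Rightarrow> ('a \<Rightarrow> complex) \<Rightarrow> complex" where
  "gauss_sum \<omega> \<psi> = (\<Sum>a\<in>UNIV - {0}. \<omega> a * \<psi> a)"

definition mat_trace :: "'a::comm_monoid_add mat \<Rightarrow> 'a" where
  "mat_trace A = (\<Sum>i<dim_row A. A $$ (i, i))"

(* For n = 0 this is the singleton of the empty matrix, whose determinant is 1 and trace 0. *)
definition invertible_symmetric_mats :: "nat \<Rightarrow> 'a::field mat set" where
  "invertible_symmetric_mats n =
     {A \<in> carrier_mat n n. transpose_mat A = A \<and> invertible_mat A}"

(* Over a finite field the index set is finite, so the sum is a genuine one. *)
definition sym_gauss_sum ::
  "nat \<Rightarrow> ('a::{field,finite} \<Rightarrow> complex) \<Rightarrow> ('a \<Rightarrow> complex) \<Rightarrow> 'a mat \<Rightarrow> complex" where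
  "sym_gauss_sum n \<omega> \<psi> T =
     (\<Sum>A\<in>invertible_symmetric_mats n. \<omega> (det A) * \<psi> (mat_trace (A * T)))"

end

theory Submission
  imports Defs
begin

text \<open>
  Write a symmetric matrix of size \<open>n + 1\<close> as a bordered matrix with corner \<open>a\<close>, border column
  \<open>v\<close> and lower block \<open>B\<close>. All the sums are computed by recursion on the size along this
  decomposition. Since a multiplicative character is extended by zero, the sums may range over all
  symmetric matrices, so that \<open>a\<close>, \<open>v\<close> and \<open>B\<close> vary independently.

  Suppose first that \<open>\<psi>\<close> is nontrivial. A congruence by a matrix of determinant one changes neither
  \<open>det T\<close> nor the sum, and in odd characteristic it can bring \<open>T\<close> to the form \<open>t \<oplus> T'\<close>
  (\<open>congruent_bordered_zero\<close>). If \<open>a = 0\<close>, the determinant of the bordered matrix is unchanged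
  under \<open>B \<mapsto> B + u v\<^sup>T + v u\<^sup>T\<close>, while \<open>\<psi> (tr (B T'))\<close> is multiplied by a factor which, for
  \<open>v \<noteq> 0\<close>, can be chosen different from 1; these terms therefore cancel. If \<open>a \<noteq> 0\<close>, replacing \<open>B\<close>
  by \<open>B + v v\<^sup>T / a\<close> turns the determinant into \<open>a det B\<close>, and summing \<open>\<psi> (v\<^sup>T T' v / a)\<close> over
  \<open>v\<close> gives \<open>\<chi> a ^ n \<chi> (det T') G ^ n\<close>, where \<open>G\<close> is the quadratic Gauss sum
  (\<open>sum_quadratic_form\<close>). The result is \<open>sym_sum_bordered\<close>, and its iteration \<open>sym_sum_eq\<close>
  expresses the sum by the Gauss sums of \<open>\<omega>\<close> and \<open>\<omega> \<chi>\<close> and powers of \<open>G\<close>. The quadratic case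
  of the Hasse-Davenport product formula (\<open>gauss_sum_duplication\<close>) and \<open>G\<^sup>2 = \<chi> (- 1) q\<close> bring
  this to the stated form.

  Now let \<open>\<psi>\<close> be trivial, so that \<open>T\<close> disappears from the sum. Congruence by a matrix of
  determinant \<open>c\<close> multiplies the sum by \<open>\<omega> c ^ 2\<close>, and scaling by \<open>c\<close> multiplies it by
  \<open>\<omega> c ^ n\<close>; this yields all the vanishing statements. In the remaining cases \<open>\<omega>\<^sup>2 = 1\<close>. The terms
  with \<open>a \<noteq> 0\<close> are treated as before, and for \<open>a = 0\<close> a congruence moves \<open>v\<close> to the first unit
  vector, after which the determinant is minus that of a block smaller by two. This gives the
  two-term recursion \<open>det_sum_Suc_Suc\<close>, which the product formulas solve.
\<close>

section \<open>Characters and Gauss sums over a finite field\<close>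

text \<open>Translation by 1 permutes the field, so comparing the sum of all elements before and after the
  translation shows that the order of the field is zero in the field.\<close>
lemma two_nonzero_of_odd_card:
  assumes "odd CARD('a::{field,finite})"
  shows "(2::'a) \<noteq> 0"
proof
  assume two: "(2::'a) = 0"
  have "(\<Sum>x\<in>(UNIV::'a set). x) = (\<Sum>x\<in>UNIV. x + 1)"
    by (rule sum.reindex_bij_witness[of _ "\<lambda>x. x + 1" "\<lambda>x. x - 1"]) auto
  then have card0: "(of_nat CARD('a) :: 'a) = 0"
    by (simp add: sum.distrib)
  obtain k where "CARD('a) = 2 * k + 1"
    using assms by (elim oddE)
  then have "(of_nat CARD('a) :: 'a) = 2 * of_nat k + 1"
    by simp
  then show False
    using card0 two by simp
qed

locale mult_char =
  fixes \<omega> :: "'a::{field,finite} \<Rightarrow> complex"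
  assumes mult_character: "mult_character \<omega>"
begin

lemma zero [simp]: "\<omega> 0 = 0"
  and eq_zero_iff [simp]: "\<omega> a = 0 \<longleftrightarrow> a = 0"
  using mult_character by (auto simp: mult_character_def)

lemma mult: "\<omega> (a * b) = \<omega> a * \<omega> b"
  using mult_character by (cases "a = 0 \<or> b = 0") (auto simp: mult_character_def)

lemma one [simp]: "\<omega> 1 = 1"
proof -
  have "\<omega> 1 \<noteq> 0" "\<omega> 1 * \<omega> 1 = \<omega> 1 * 1"
    using mult[of 1 1] by simp_all
  then show ?thesis
    by (metis mult_left_cancel)
qed

lemma power: "\<omega> (a ^ k) = \<omega> a ^ k"
  by (induction k) (auto simp: mult)

lemma inverse: "\<omega> (inverse a) = inverse (\<omega> a)"
  using mult[of a "inverse a"] by (cases "a = 0") (auto simp: field_simps)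

lemma divide: "\<omega> (a / b) = \<omega> a / \<omega> b"
  by (simp add: divide_inverse mult inverse)

lemma sum_eq_zero:
  assumes "\<omega> \<noteq> trivial_mult_character"
  shows "(\<Sum>a\<in>UNIV. \<omega> a) = 0"
proof -
  obtain c where c: "c \<noteq> 0" "\<omega> c \<noteq> 1"
  proof -
    obtain c where "\<omega> c \<noteq> trivial_mult_character c"
      using assms by blast
    then show ?thesis
      using that[of c] by (cases "c = 0") (auto simp: trivial_mult_character_def)
  qed
  have "(\<Sum>a\<in>UNIV. \<omega> a) = (\<Sum>a\<in>UNIV. \<omega> (c * a))"
    using c by (intro sum.reindex_bij_witness[of _ "\<lambda>a. c * a" "\<lambda>a. a / c"]) auto
  also have "\<dots> = \<omega> c * (\<Sum>a\<in>UNIV. \<omega> a)"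
    by (simp add: mult sum_distrib_left)
  finally show ?thesis
    using c by simp
qed

lemma gauss_sum_eq: "gauss_sum \<omega> \<psi> = (\<Sum>a\<in>UNIV. \<omega> a * \<psi> a)"
  unfolding gauss_sum_def by (intro sum.mono_neutral_left) auto

end

lemma mult_character_times_power:
  assumes "mult_character \<omega>" "mult_character \<chi>"
  shows "mult_character (\<lambda>a. \<omega> a * \<chi> a ^ k)"
  using assms by (auto simp: mult_character_def power_mult_distrib)

locale quadratic_char = mult_char \<chi> for \<chi> :: "'a::{field,finite} \<Rightarrow> complex" +
  assumes nontrivial: "\<chi> \<noteq> trivial_mult_character"
    and square: "a \<noteq> 0 \<Longrightarrow> \<chi> a ^ 2 = 1"
    and two_nonzero: "(2::'a) \<noteq> 0"
begin

lemma four_nonzero: "(4::'a) \<noteq> 0"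
proof -
  have "(4::'a) = 2 * 2" by simp
  then show ?thesis using two_nonzero by (metis mult_eq_0_iff)
qed

lemma value_cases: "a \<noteq> 0 \<Longrightarrow> \<chi> a = 1 \<or> \<chi> a = - 1"
  using square[of a] by (simp add: power2_eq_1_iff)

lemma mult_self: "a \<noteq> 0 \<Longrightarrow> \<chi> a * \<chi> a = 1"
  using square[of a] by (simp add: power2_eq_square)

text \<open>Abstractly, \<open>\<chi>\<close> is only known to be nontrivial and of square one. Nonzero squares have two roots
  and the value 1; that the value is -1 at all other nonzero elements follows from the vanishing of
  the sum of \<open>\<chi>\<close>. In particular \<open>\<chi>\<close> is determined by these properties.\<close>
lemma card_square_roots:
  assumes "b \<noteq> 0"
  shows "of_nat (card {x. x ^ 2 = b}) = 1 + \<chi> b"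
proof -
  define r :: "'a \<Rightarrow> real" where "r b = card {x. x ^ 2 = b}" for b
  \<comment> \<open>The two sides have the same sum over the nonzero field elements, and the left side never
    exceeds the right one; hence they agree everywhere.\<close>
  have roots: "r b = 2" "\<chi> b = 1" if "b = y ^ 2" "b \<noteq> 0" for b y
  proof -
    have "{x. x ^ 2 = b} = {y, - y}"
      using that by (auto simp: power2_eq_iff)
    moreover have "y \<noteq> - y"
    proof
      assume "y = - y"
      then have "2 * y = 0" by (metis add.right_inverse mult_2)
      then show False using that two_nonzero by auto
    qed
    ultimately show "r b = 2" by (simp add: r_def)
    show "\<chi> b = 1"
      using that by (auto simp: power square)
  qed
  have le: "r b \<le> 1 + Re (\<chi> b)" if "b \<noteq> 0" for b
  proof (cases "\<exists>y. b = y ^ 2")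
    case True
    then show ?thesis using roots that by force
  next
    case False
    then have "{x. x ^ 2 = b} = {}" by auto
    then have "r b = 0" by (simp add: r_def)
    then show ?thesis using value_cases[OF that] by auto
  qed
  have "card (- {0::'a}) = card (\<Union>b\<in>-{0::'a}. {x. x ^ 2 = b})"
    by (rule arg_cong[of _ _ card]) auto
  also have "\<dots> = (\<Sum>b\<in>-{0::'a}. card {x. x ^ 2 = b})"
    by (rule card_UN_disjoint) auto
  finally have sum_r: "(\<Sum>b\<in>-{0}. r b) = card (- {0::'a})"
    by (simp add: r_def flip: of_nat_sum)
  have "(\<Sum>b\<in>-{0}. \<chi> b) = (\<Sum>b\<in>UNIV. \<chi> b)"
    by (intro sum.mono_neutral_left) auto
  then have "(\<Sum>b\<in>-{0}. \<chi> b) = 0"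
    using sum_eq_zero[OF nontrivial] by simp
  then have "(\<Sum>b\<in>-{0}. Re (\<chi> b)) = 0"
    by (metis Re_sum zero_complex.sel(1))
  then have "(\<Sum>b\<in>-{0}. 1 + Re (\<chi> b) - r b) = 0"
    by (simp add: sum.distrib sum_subtractf sum_r)
  then have "1 + Re (\<chi> b) - r b = 0"
    using le assms by (subst (asm) sum_nonneg_eq_0_iff) auto
  moreover have "\<chi> b = of_real (Re (\<chi> b))"
    using value_cases[OF assms] by auto
  ultimately show ?thesis
    by (metis add.commute diff_eq_eq add_0 of_real_1 of_real_add of_real_of_nat_eq r_def)
qed

lemma sum_squares:
  fixes f :: "'a \<Rightarrow> complex"
  shows "(\<Sum>x\<in>UNIV. f (x ^ 2)) = (\<Sum>b\<in>UNIV. (1 + \<chi> b) * f b)"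
proof -
  have "(\<Sum>x\<in>UNIV. f (x ^ 2)) = (\<Sum>b\<in>UNIV. \<Sum>x\<in>{x. x ^ 2 = b}. f (x ^ 2))"
    using sum.group[of UNIV UNIV "\<lambda>x::'a. x ^ 2" "\<lambda>x. f (x ^ 2)"] by simp
  also have "\<dots> = (\<Sum>b\<in>UNIV. of_nat (card {x. x ^ 2 = b}) * f b)"
    by (intro sum.cong) auto
  also have "\<dots> = (\<Sum>b\<in>UNIV. (1 + \<chi> b) * f b)"
  proof (intro sum.cong refl)
    fix b :: 'a
    have "{x. x ^ 2 = (0::'a)} = {0}" by auto
    then show "of_nat (card {x. x ^ 2 = b}) * f b = (1 + \<chi> b) * f b"
      using card_square_roots[of b] by (cases "b = 0") auto
  qed
  finally show ?thesis .
qed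

end

lemma quadratic_char_unique:
  assumes "quadratic_char \<omega>" "quadratic_char \<chi>"
  shows "\<omega> = \<chi>"
proof
  fix b
  interpret w: quadratic_char \<omega> by fact
  interpret x: quadratic_char \<chi> by fact
  show "\<omega> b = \<chi> b"
    using w.card_square_roots[of b] x.card_square_roots[of b] by (cases "b = 0") auto
qed

locale nontrivial_add_char =
  fixes \<psi> :: "'a::{field,finite} \<Rightarrow> complex"
  assumes add_character: "add_character \<psi>"
    and nontrivial: "\<psi> \<noteq> trivial_add_character"
begin

lemma add: "\<psi> (a + b) = \<psi> a * \<psi> b"
  using add_character by (auto simp: add_character_def)

lemma zero [simp]: "\<psi> 0 = 1"
proof -
  have "\<psi> 0 \<noteq> 0" "\<psi> 0 * \<psi> 0 = \<psi> 0 * 1"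
    using add[of 0 0] add_character by (simp_all add: add_character_def)
  then show ?thesis
    by (metis mult_left_cancel)
qed

lemma nontrivial_value: obtains b where "\<psi> b \<noteq> 1"
  using nontrivial by (metis ext trivial_add_character_def)

lemma sum_mult:
  "(\<Sum>a\<in>UNIV. \<psi> (a * c)) = (if c = 0 then of_nat CARD('a) else 0)"
proof (cases "c = 0")
  case False
  obtain b where b: "\<psi> b \<noteq> 1" by (rule nontrivial_value)
  have "(\<Sum>a\<in>UNIV. \<psi> (a * c)) = (\<Sum>a\<in>UNIV. \<psi> (b + a * c))"
    using False
    by (intro sum.reindex_bij_witness[of _ "\<lambda>a. a + b / c" "\<lambda>a. a - b / c"])
      (auto simp: field_simps)
  also have "\<dots> = \<psi> b * (\<Sum>a\<in>UNIV. \<psi> (a * c))"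
    by (simp add: add sum_distrib_left)
  finally show ?thesis
    using b False by simp
qed simp

lemma gauss_sum_dilate:
  assumes "mult_character \<omega>" "c \<noteq> 0"
  shows "(\<Sum>a\<in>UNIV. \<omega> a * \<psi> (a * c)) = gauss_sum \<omega> \<psi> / \<omega> c"
proof -
  interpret w: mult_char \<omega> by unfold_locales fact
  have "(\<Sum>a\<in>UNIV. \<omega> a * \<psi> (a * c)) = (\<Sum>a\<in>UNIV. \<omega> (a / c) * \<psi> a)"
    using assms
    by (intro sum.reindex_bij_witness[of _ "\<lambda>a. a / c" "\<lambda>a. a * c"]) auto
  then show ?thesis
    by (simp add: w.divide w.gauss_sum_eq sum_divide_distrib)
qed

end

locale quadratic_gauss = quadratic_char \<chi> + nontrivial_add_char \<psi>
  for \<chi> \<psi> :: "'a::{field,finite} \<Rightarrow> complex"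
begin

abbreviation G :: complex where "G \<equiv> gauss_sum \<chi> \<psi>"

lemma sum_square_mult:
  assumes "c \<noteq> 0"
  shows "(\<Sum>x\<in>UNIV. \<psi> (x ^ 2 * c)) = \<chi> c * G"
proof -
  have "(\<Sum>x\<in>UNIV. \<psi> (x ^ 2 * c)) = (\<Sum>b\<in>UNIV. \<psi> (b * c)) + (\<Sum>b\<in>UNIV. \<chi> b * \<psi> (b * c))"
    by (subst sum_squares) (simp add: ring_distribs sum.distrib)
  also have "\<dots> = G / \<chi> c"
    using assms gauss_sum_dilate[OF mult_character] by (simp add: sum_mult)
  finally show ?thesis
    using value_cases[OF assms] by auto
qed

text \<open>Multiply \<open>\<Sum>\<psi>(x\<^sup>2)\<close> by \<open>\<Sum>\<psi>(- y\<^sup>2)\<close> and factor \<open>x\<^sup>2 - y\<^sup>2\<close>: in the coordinates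
  \<open>x - y\<close> and \<open>x + y\<close> the double sum is one of \<open>\<psi>(u v)\<close>.\<close>
lemma G_square: "G ^ 2 = \<chi> (- 1) * of_nat CARD('a)"
proof -
  have "\<chi> (- 1) * G ^ 2 = (\<Sum>x\<in>UNIV. \<psi> (x ^ 2 * 1)) * (\<Sum>y\<in>UNIV. \<psi> (y ^ 2 * (- 1)))"
    by (subst (1 2) sum_square_mult) (auto simp: power2_eq_square)
  also have "\<dots> = (\<Sum>(x,y)\<in>UNIV. \<psi> (x ^ 2 - y ^ 2))"
    by (simp add: sum_product sum.cartesian_product flip: add)
  also have "\<dots> = (\<Sum>(u,v)\<in>UNIV. \<psi> (u * v))"
    using two_nonzero four_nonzero
    by (intro sum.reindex_bij_witness[of _ "\<lambda>(u,v). ((u + v) / 2, (v - u) / 2)"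
        "\<lambda>(x,y). (x - y, x + y)"]) (auto simp: field_simps power2_eq_square)
  also have "\<dots> = (\<Sum>v\<in>UNIV. \<Sum>u\<in>UNIV. \<psi> (u * v))"
    by (subst sum.swap) (simp add: sum.cartesian_product)
  also have "\<dots> = of_nat CARD('a)"
    by (simp add: sum_mult)
  finally have "\<chi> (- 1) * G ^ 2 = of_nat CARD('a)" .
  then have "\<chi> (- 1) * \<chi> (- 1) * G ^ 2 = \<chi> (- 1) * of_nat CARD('a)"
    by simp
  then show ?thesis
    by (simp add: mult_self)
qed

text \<open>The quadratic case of the Hasse-Davenport product formula. After multiplication by
  \<open>\<chi>(- 1) G\<close>, the factor \<open>\<chi> b\<close> in the second Gauss sum is absorbed into
  \<open>\<chi>(- b) G = \<Sum>\<psi>(- u\<^sup>2 / b)\<close>. With \<open>p = a b\<close> and \<open>u\<close> shifted by \<open>b\<close>, the argument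
  of \<open>\<psi>\<close> becomes \<open>(p - u\<^sup>2) / b - 2 u\<close>, and summing over \<open>b\<close> forces \<open>p = u\<^sup>2\<close>.\<close>
lemma gauss_sum_duplication:
  assumes "mult_character \<omega>"
  shows "gauss_sum \<omega> \<psi> * gauss_sum (\<lambda>a. \<omega> a * \<chi> a) \<psi>
    = G * gauss_sum (\<lambda>a. \<omega> a ^ 2) \<psi> / \<omega> 4"
proof -
  interpret w: mult_char \<omega> by unfold_locales fact
  interpret w2: mult_char "\<lambda>a. \<omega> a ^ 2"
    using assms by unfold_locales (auto simp: mult_character_def power_mult_distrib)
  let ?q = "of_nat CARD('a) :: complex"
  define W where "W = (\<Sum>a\<in>UNIV. \<omega> a * \<psi> a)"
  have b_part: "W * (\<omega> b * \<psi> b * (\<chi> (- b) * G))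
      = (\<Sum>u\<in>UNIV. \<Sum>p\<in>UNIV. \<omega> p * \<psi> ((p - u ^ 2) / b) * \<psi> (- 2 * u))"
    if b: "b \<noteq> 0" for b
  proof -
    have "\<chi> (- b) * G = (\<Sum>u\<in>UNIV. \<psi> (u ^ 2 * (- 1 / b)))"
      using b divide[of "- 1" b] mult[of "- 1" b] value_cases[of b]
      by (subst sum_square_mult) auto
    also have "\<dots> = (\<Sum>u\<in>UNIV. \<psi> ((u + b) ^ 2 * (- 1 / b)))"
      by (intro sum.reindex_bij_witness[of _ "\<lambda>u. u + b" "\<lambda>u. u - b"]) auto
    finally have u_sum: "\<chi> (- b) * G = (\<Sum>u\<in>UNIV. \<psi> ((u + b) ^ 2 * (- 1 / b)))" .
    have "W * \<omega> b = (\<Sum>a\<in>UNIV. \<omega> (a * b) * \<psi> a)"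
      by (simp add: W_def w.mult sum_distrib_left sum_distrib_right mult_ac)
    also have "\<dots> = (\<Sum>p\<in>UNIV. \<omega> p * \<psi> (p / b))"
      using b by (intro sum.reindex_bij_witness[of _ "\<lambda>p. p / b" "\<lambda>a. a * b"]) auto
    finally have a_sum: "W * \<omega> b = (\<Sum>p\<in>UNIV. \<omega> p * \<psi> (p / b))" .
    have "W * (\<omega> b * \<psi> b * (\<chi> (- b) * G)) = W * \<omega> b * \<psi> b * (\<chi> (- b) * G)"
      by (simp only: mult.assoc)
    also have "\<dots> = (\<Sum>u\<in>UNIV. \<Sum>p\<in>UNIV. \<omega> p * (\<psi> (p / b) * \<psi> b * \<psi> ((u + b) ^ 2 * (- 1 / b))))"
      unfolding a_sum u_sum by (simp add: sum_distrib_right sum_distrib_left mult_ac)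
    also have "\<dots> = (\<Sum>u\<in>UNIV. \<Sum>p\<in>UNIV. \<omega> p * \<psi> ((p - u ^ 2) / b) * \<psi> (- 2 * u))"
    proof (intro sum.cong refl)
      fix u p
      have "p / b + b + (u + b) ^ 2 * (- 1 / b) = (p - u ^ 2) / b + (- 2 * u)"
        using b by (simp add: field_simps power2_eq_square)
      then show "\<omega> p * (\<psi> (p / b) * \<psi> b * \<psi> ((u + b) ^ 2 * (- 1 / b)))
          = \<omega> p * \<psi> ((p - u ^ 2) / b) * \<psi> (- 2 * u)"
        by (metis add mult.assoc)
    qed
    finally show ?thesis .
  qed
  have inner: "(\<Sum>b\<in>UNIV - {0}. \<psi> (d / b)) = (if d = 0 then ?q else 0) - 1" for d :: 'a
  proof -
    have "(\<Sum>b\<in>UNIV - {0}. \<psi> (d / b)) = (\<Sum>b\<in>UNIV - {0}. \<psi> (b * d))"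
      by (intro sum.reindex_bij_witness[of _ inverse inverse]) (auto simp: field_simps)
    also have "\<dots> = (\<Sum>b\<in>UNIV. \<psi> (b * d)) - 1"
      by (subst sum_diff1) auto
    finally show ?thesis by (simp add: sum_mult)
  qed
  have "gauss_sum \<omega> \<psi> * gauss_sum (\<lambda>a. \<omega> a * \<chi> a) \<psi> * (\<chi> (- 1) * G)
      = (\<Sum>b\<in>UNIV - {0}. W * (\<omega> b * \<psi> b * (\<chi> (- b) * G)))"
  proof -
    have "gauss_sum \<omega> \<psi> * gauss_sum (\<lambda>a. \<omega> a * \<chi> a) \<psi> * (\<chi> (- 1) * G)
        = (\<Sum>b\<in>UNIV - {0}. W * (\<omega> b * \<chi> b * \<psi> b * (\<chi> (- 1) * G)))"
      unfolding w.gauss_sum_eq W_def[symmetric]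
      unfolding gauss_sum_def[of "\<lambda>a. \<omega> a * \<chi> a"]
      by (simp only: sum_distrib_left sum_distrib_right mult.assoc)
    also have "\<dots> = (\<Sum>b\<in>UNIV - {0}. W * (\<omega> b * \<psi> b * (\<chi> (- b) * G)))"
    proof (intro sum.cong refl)
      fix b
      have "\<chi> (- b) = \<chi> b * \<chi> (- 1)"
        using mult[of b "- 1"] by simp
      then show "W * (\<omega> b * \<chi> b * \<psi> b * (\<chi> (- 1) * G)) = W * (\<omega> b * \<psi> b * (\<chi> (- b) * G))"
        by simp
    qed
    finally show ?thesis .
  qed
  also have "\<dots> = (\<Sum>b\<in>UNIV - {0}. \<Sum>u\<in>UNIV. \<Sum>p\<in>UNIV. \<omega> p * \<psi> ((p - u ^ 2) / b) * \<psi> (- 2 * u))"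
    by (intro sum.cong refl b_part) auto
  also have "\<dots> = (\<Sum>u\<in>UNIV. \<Sum>p\<in>UNIV. \<Sum>b\<in>UNIV - {0}. \<omega> p * \<psi> ((p - u ^ 2) / b) * \<psi> (- 2 * u))"
    by (subst sum.swap, rule sum.cong[OF refl], rule sum.swap)
  also have "\<dots> = (\<Sum>u\<in>UNIV. \<Sum>p\<in>UNIV. \<omega> p * \<psi> (- 2 * u) * (\<Sum>b\<in>UNIV - {0}. \<psi> ((p - u ^ 2) / b)))"
    by (simp only: sum_distrib_left) (simp only: mult_ac)
  also have "\<dots> = (\<Sum>u\<in>UNIV. \<Sum>p\<in>UNIV. \<omega> p * \<psi> (- 2 * u) * (if p = u ^ 2 then ?q else 0))
      - (\<Sum>u\<in>UNIV. \<Sum>p\<in>UNIV. \<omega> p * \<psi> (- 2 * u))"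
    by (simp only: inner right_diff_distrib sum_subtractf right_minus_eq mult_1_right)
  also have "(\<Sum>u\<in>UNIV. \<Sum>p\<in>UNIV. \<omega> p * \<psi> (- 2 * u))
      = (\<Sum>u\<in>UNIV. \<psi> (u * (- 2))) * (\<Sum>p\<in>UNIV. \<omega> p)"
    by (subst sum.swap) (simp only: sum_product mult.commute)
  also have "\<dots> = 0"
    using two_nonzero by (subst sum_mult) auto
  also have "(\<Sum>u\<in>UNIV. \<Sum>p\<in>UNIV. \<omega> p * \<psi> (- 2 * u) * (if p = u ^ 2 then ?q else 0))
      = ?q * (\<Sum>u\<in>UNIV. \<omega> u ^ 2 * \<psi> (u * (- 2)))"
    by (simp add: if_distrib cong: if_cong) (simp add: sum_distrib_left w.power mult_ac)
  also have "(\<Sum>u\<in>UNIV. \<omega> u ^ 2 * \<psi> (u * (- 2))) = gauss_sum (\<lambda>a. \<omega> a ^ 2) \<psi> / \<omega> 4"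
    using two_nonzero w.power[of "-2" 2]
    by (subst gauss_sum_dilate[OF w2.mult_character]) auto
  finally have *: "gauss_sum \<omega> \<psi> * gauss_sum (\<lambda>a. \<omega> a * \<chi> a) \<psi> * (\<chi> (- 1) * G)
      = ?q * (gauss_sum (\<lambda>a. \<omega> a ^ 2) \<psi> / \<omega> 4)" by simp
  have "\<chi> (- 1) * G * G = ?q"
    using G_square mult_self[of "- 1"] by (simp add: power2_eq_square mult.assoc)
  then have "gauss_sum \<omega> \<psi> * gauss_sum (\<lambda>a. \<omega> a * \<chi> a) \<psi> * ?q
      = gauss_sum \<omega> \<psi> * gauss_sum (\<lambda>a. \<omega> a * \<chi> a) \<psi> * (\<chi> (- 1) * G) * G"
    by (simp add: mult_ac)
  also have "\<dots> = (G * gauss_sum (\<lambda>a. \<omega> a ^ 2) \<psi> / \<omega> 4) * ?q"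
    by (simp only: *) (simp add: mult_ac)
  finally show ?thesis
    by (metis mult_right_cancel of_nat_eq_0_iff zero_less_card_finite less_irrefl)
qed

end

section \<open>Symmetric matrices under congruence\<close>

definition sym_mats :: "nat \<Rightarrow> 'a::zero mat set" where
  "sym_mats n = {A \<in> carrier_mat n n. transpose_mat A = A}"

lemma sym_matsI: "A \<in> carrier_mat n n \<Longrightarrow> transpose_mat A = A \<Longrightarrow> A \<in> sym_mats n"
  by (simp add: sym_mats_def)

lemma sym_mats_carrier [dest]: "A \<in> sym_mats n \<Longrightarrow> A \<in> carrier_mat n n"
  and sym_mats_transpose: "A \<in> sym_mats n \<Longrightarrow> transpose_mat A = A"
  by (simp_all add: sym_mats_def)

lemma sym_mats_index:
  assumes "A \<in> sym_mats n" "i < n" "j < n"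
  shows "A $$ (i, j) = A $$ (j, i)"
  using assms by (metis sym_mats_carrier sym_mats_transpose carrier_matD index_transpose_mat(1))

lemma invertible_mat_iff_det:
  fixes A :: "'a::field mat"
  assumes A: "A \<in> carrier_mat n n"
  shows "invertible_mat A \<longleftrightarrow> det A \<noteq> 0"
proof
  assume "invertible_mat A"
  then obtain B where B: "A * B = 1\<^sub>m n" "B * A = 1\<^sub>m (dim_row B)"
    using A by (auto simp: invertible_mat_def inverts_mat_def)
  have "dim_row (B * A) = dim_row B" "dim_col (B * A) = n" "dim_col (A * B) = dim_col B"
    using A by auto
  then have "B \<in> carrier_mat n n"
    using B by (metis carrier_matI index_one_mat(2,3))
  then have "det A * det B = 1"
    using B A by (metis det_mult det_one)
  then show "det A \<noteq> 0" by auto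
next
  assume "det A \<noteq> 0"
  then have "A \<in> Units (ring_mat TYPE('a) n ())"
    by (rule det_non_zero_imp_unit[OF A])
  then show "invertible_mat A"
    using A by (auto simp: Units_def ring_mat_def invertible_mat_def inverts_mat_def)
qed

lemma invertible_symmetric_mats_eq:
  "invertible_symmetric_mats n = {A \<in> sym_mats n. det A \<noteq> (0::'a::field)}"
  by (auto simp: invertible_symmetric_mats_def sym_mats_def invertible_mat_iff_det)

lemma obtain_inverse:
  fixes P :: "'a::field mat"
  assumes "P \<in> carrier_mat n n" "det P \<noteq> 0"
  obtains Q where "Q \<in> carrier_mat n n" "P * Q = 1\<^sub>m n" "Q * P = 1\<^sub>m n"
  using det_non_zero_imp_unit[OF assms, of "()"] by (auto simp: Units_def ring_mat_def)

lemma finite_carrier_mat: "finite (carrier_mat m n :: 'a::finite mat set)"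
  and card_carrier_mat: "card (carrier_mat m n :: 'a::finite mat set) = CARD('a) ^ (m * n)"
proof -
  let ?I = "{..<m} \<times> {..<n}"
  have bij: "bij_betw (\<lambda>A. restrict (($$) A) ?I) (carrier_mat m n) (?I \<rightarrow>\<^sub>E (UNIV :: 'a set))"
  proof (intro bij_betw_byWitness[where f' = "\<lambda>f. mat m n f"] ballI)
    fix A :: "'a mat" assume "A \<in> carrier_mat m n"
    then show "mat m n (restrict (($$) A) ?I) = A" by (intro eq_matI) auto
  next
    fix f :: "nat \<times> nat \<Rightarrow> 'a" assume "f \<in> ?I \<rightarrow>\<^sub>E UNIV"
    then show "restrict (($$) (mat m n f)) ?I = f"
      by (auto simp: fun_eq_iff PiE_def extensional_def)
  qed (simp_all add: image_subset_iff restrict_PiE_iff)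
  have "finite (?I \<rightarrow>\<^sub>E (UNIV :: 'a set))"
    by (intro finite_PiE) auto
  then show "finite (carrier_mat m n :: 'a mat set)"
    using bij by (simp add: bij_betw_finite)
  show "card (carrier_mat m n :: 'a mat set) = CARD('a) ^ (m * n)"
    using bij_betw_same_card[OF bij] by (simp add: card_PiE)
qed

lemma finite_sym_mats [simp]: "finite (sym_mats n :: 'a::{finite,zero} mat set)"
  by (rule finite_subset[OF _ finite_carrier_mat]) auto

lemma sym_mats_congruence:
  fixes P :: "'a::comm_ring_1 mat"
  assumes "P \<in> carrier_mat m n" "A \<in> sym_mats n"
  shows "P * A * transpose_mat P \<in> sym_mats m"
proof (rule sym_matsI)
  have A: "A \<in> carrier_mat n n" using assms by auto
  show "P * A * transpose_mat P \<in> carrier_mat m m"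
    using assms A by auto
  have "transpose_mat (P * A * transpose_mat P) = P * (transpose_mat A * transpose_mat P)"
    using assms(1) A transpose_mult[of P m n A n]
      transpose_mult[of "P * A" m n "transpose_mat P" m] by simp
  then show "transpose_mat (P * A * transpose_mat P) = P * A * transpose_mat P"
    using assms A by (simp add: sym_mats_transpose assoc_mult_mat[of _ m n _ n _ m])
qed

lemma det_congruence:
  fixes P :: "'a::comm_ring_1 mat"
  assumes "P \<in> carrier_mat n n" "A \<in> carrier_mat n n"
  shows "det (P * A * transpose_mat P) = det P ^ 2 * det A"
  using assms by (simp add: det_mult[of _ n] det_transpose power2_eq_square mult_ac)

lemma bij_betw_congruence:
  fixes P :: "'a::{field,finite} mat"
  assumes P: "P \<in> carrier_mat n n" "det P \<noteq> 0"
  shows "bij_betw (\<lambda>A. P * A * transpose_mat P) (sym_mats n) (sym_mats n)"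
proof -
  obtain Q where Q: "Q \<in> carrier_mat n n" "Q * P = 1\<^sub>m n"
    by (rule obtain_inverse[OF P])
  have Qt: "transpose_mat P * transpose_mat Q = 1\<^sub>m n"
    using arg_cong[OF Q(2), of transpose_mat] transpose_mult[OF Q(1) P(1)] by simp
  have "Q * (P * A * transpose_mat P) * transpose_mat Q = A" if "A \<in> sym_mats n" for A
  proof -
    have A: "A \<in> carrier_mat n n" using that by auto
    have "Q * (P * A * transpose_mat P) * transpose_mat Q
        = (Q * P) * A * (transpose_mat P * transpose_mat Q)"
      using P Q(1) A by (simp add: assoc_mult_mat[of _ n n _ n _ n])
    then show ?thesis
      using Q Qt A by simp
  qed
  then have "inj_on (\<lambda>A. P * A * transpose_mat P) (sym_mats n)"
    by (rule inj_on_inverseI)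
  moreover have "(\<lambda>A. P * A * transpose_mat P) ` sym_mats n \<subseteq> sym_mats n"
    using sym_mats_congruence[OF P(1)] by auto
  ultimately show ?thesis
    unfolding bij_betw_def by (metis endo_inj_surj finite_sym_mats)
qed

lemma bij_betw_mult_left:
  fixes P :: "'a::{field,finite} mat"
  assumes P: "P \<in> carrier_mat n n" "det P \<noteq> 0"
  shows "bij_betw (\<lambda>v. P * v) (carrier_mat n k) (carrier_mat n k)"
proof -
  obtain Q where Q: "Q \<in> carrier_mat n n" "Q * P = 1\<^sub>m n"
    by (rule obtain_inverse[OF P])
  have "Q * (P * v) = v" if "v \<in> carrier_mat n k" for v
    using that P Q assoc_mult_mat[of Q n n P n v k] by simp
  then have "inj_on (\<lambda>v. P * v) (carrier_mat n k)"
    by (rule inj_on_inverseI)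
  moreover have "(\<lambda>v. P * v) ` carrier_mat n k \<subseteq> carrier_mat n k"
    using P by auto
  ultimately show ?thesis
    unfolding bij_betw_def by (metis endo_inj_surj finite_carrier_mat)
qed

lemma mat_trace_mult:
  fixes A :: "'a::comm_semiring_0 mat"
  assumes "A \<in> carrier_mat m n" "B \<in> carrier_mat n m"
  shows "mat_trace (A * B) = (\<Sum>i<m. \<Sum>j<n. A $$ (i, j) * B $$ (j, i))"
  using assms by (auto simp: mat_trace_def scalar_prod_def atLeast0LessThan intro!: sum.cong)

lemma mat_trace_comm:
  fixes A :: "'a::comm_semiring_0 mat"
  assumes "A \<in> carrier_mat m n" "B \<in> carrier_mat n m"
  shows "mat_trace (A * B) = mat_trace (B * A)"
  unfolding mat_trace_mult[OF assms] mat_trace_mult[OF assms(2,1)]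
  by (subst sum.swap) (simp add: mult.commute)

lemma mat_trace_add:
  "A \<in> carrier_mat n n \<Longrightarrow> B \<in> carrier_mat n n \<Longrightarrow> mat_trace (A + B) = mat_trace A + mat_trace B"
  by (auto simp: mat_trace_def sum.distrib)

lemma mat_trace_transpose:
  "A \<in> carrier_mat n n \<Longrightarrow> mat_trace (transpose_mat A) = mat_trace A"
  by (auto simp: mat_trace_def)

lemma mat_trace_congruence:
  fixes P :: "'a::comm_ring_1 mat"
  assumes "P \<in> carrier_mat n n" "A \<in> carrier_mat n n" "T \<in> carrier_mat n n"
  shows "mat_trace (A * (P * T * transpose_mat P)) = mat_trace (transpose_mat P * A * P * T)"
proof -
  have "A * (P * T * transpose_mat P) = (A * P * T) * transpose_mat P"
    using assms by (simp add: assoc_mult_mat[of _ n n _ n _ n])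
  also have "mat_trace \<dots> = mat_trace (transpose_mat P * (A * P * T))"
    using assms by (intro mat_trace_comm[of _ n n]) auto
  also have "transpose_mat P * (A * P * T) = transpose_mat P * A * P * T"
    using assms by (simp add: assoc_mult_mat[of _ n n _ n _ n])
  finally show ?thesis .
qed

section \<open>Bordered symmetric matrices\<close>

text \<open>Columns are matrices with one column rather than vectors, so that outer products and quadratic
  forms are matrix products and the block multiplication lemmas apply to borders.\<close>
definition bordered :: "'a::semiring_1 \<Rightarrow> 'a mat \<Rightarrow> 'a mat \<Rightarrow> 'a mat" where
  "bordered a v B = four_block_mat (a \<cdot>\<^sub>m 1\<^sub>m 1) (transpose_mat v) v B"

abbreviation cross :: "'a::semiring_1 mat \<Rightarrow> 'a mat \<Rightarrow> 'a mat" where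
  "cross u v \<equiv> u * transpose_mat v + v * transpose_mat u"

lemma bordered_carrier [simp]:
  "B \<in> carrier_mat n n \<Longrightarrow> bordered a v B \<in> carrier_mat (Suc n) (Suc n)"
  by (auto simp: bordered_def)

lemma bordered_sym:
  assumes "v \<in> carrier_mat n 1" "B \<in> sym_mats n"
  shows "bordered a v B \<in> sym_mats (Suc n)"
proof (rule sym_matsI)
  have B: "B \<in> carrier_mat n n" using assms by auto
  then show "bordered a v B \<in> carrier_mat (Suc n) (Suc n)" by simp
  have "transpose_mat (a \<cdot>\<^sub>m 1\<^sub>m 1) = a \<cdot>\<^sub>m 1\<^sub>m 1" by (intro eq_matI) auto
  then show "transpose_mat (bordered a v B) = bordered a v B"
    using assms B unfolding bordered_def
    by (subst transpose_four_block_mat[of _ 1 1 _ n _ n]) (auto simp: sym_mats_transpose)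
qed

lemma bordered_inject:
  assumes "v \<in> carrier_mat n 1" "B \<in> carrier_mat n n" "v' \<in> carrier_mat n 1" "B' \<in> carrier_mat n n"
    and eq: "bordered a v B = bordered a' v' B'"
  shows "a = a' \<and> v = v' \<and> B = B'"
proof -
  have *: "bordered a v B $$ (i, j) = bordered a' v' B' $$ (i, j)" for i j
    using eq by simp
  have "a = a'"
    using *[of 0 0] assms by (simp add: bordered_def)
  moreover have "v = v'"
  proof (rule eq_matI)
    fix i j assume "i < dim_row v'" "j < dim_col v'"
    then show "v $$ (i, j) = v' $$ (i, j)"
      using *[of "Suc i" 0] assms by (simp add: bordered_def)
  qed (use assms in auto)
  moreover have "B = B'"
  proof (rule eq_matI)
    fix i j assume "i < dim_row B'" "j < dim_col B'"
    then show "B $$ (i, j) = B' $$ (i, j)"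
      using *[of "Suc i" "Suc j"] assms by (simp add: bordered_def)
  qed (use assms in auto)
  ultimately show ?thesis by simp
qed

lemma sym_mats_Suc_cases:
  assumes A: "A \<in> sym_mats (Suc n)"
  obtains a v B where "v \<in> carrier_mat n 1" "B \<in> sym_mats n" "A = bordered a v B"
    "a = A $$ (0, 0)"
proof -
  have Ac: "A \<in> carrier_mat (Suc n) (Suc n)" using A by auto
  define v where "v = mat n 1 (\<lambda>(i, _). A $$ (Suc i, 0))"
  define B where "B = mat n n (\<lambda>(i, j). A $$ (Suc i, Suc j))"
  have "v \<in> carrier_mat n 1" by (simp add: v_def)
  moreover have "B \<in> sym_mats n"
    using sym_mats_index[OF A] by (auto simp: B_def sym_mats_def)
  moreover have "A = bordered (A $$ (0, 0)) v B"
  proof (rule eq_matI)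
    fix i j assume "i < dim_row (bordered (A $$ (0, 0)) v B)" "j < dim_col (bordered (A $$ (0, 0)) v B)"
    then have ij: "i < Suc n" "j < Suc n" by (auto simp: bordered_def B_def)
    show "A $$ (i, j) = bordered (A $$ (0, 0)) v B $$ (i, j)"
      using ij sym_mats_index[OF A, of 0 j]
      by (cases i; cases j) (auto simp: bordered_def B_def v_def)
  qed (use Ac in \<open>auto simp: bordered_def B_def\<close>)
  ultimately show ?thesis using that by blast
qed

lemma sum_sym_mats_Suc:
  fixes f :: "'a::{comm_ring_1,finite} mat \<Rightarrow> complex"
  shows "(\<Sum>A\<in>sym_mats (Suc n). f A)
    = (\<Sum>a\<in>UNIV. \<Sum>v\<in>carrier_mat n 1. \<Sum>B\<in>sym_mats n. f (bordered a v B))"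
proof -
  let ?X = "UNIV \<times> carrier_mat n 1 \<times> sym_mats n :: ('a \<times> 'a mat \<times> 'a mat) set"
  let ?b = "\<lambda>(a, v, B). bordered a v B"
  have "inj_on ?b ?X"
  proof (rule inj_onI)
    fix x y assume xy: "x \<in> ?X" "y \<in> ?X" "?b x = ?b y"
    obtain a v B a' v' B' where "x = (a, v, B)" "y = (a', v', B')"
      by (cases x; cases y) auto
    then show "x = y"
      using xy bordered_inject[of v n B v' B' a a'] by auto
  qed
  moreover have "?b ` ?X = sym_mats (Suc n)"
  proof
    show "?b ` ?X \<subseteq> sym_mats (Suc n)"
      using bordered_sym by auto
    show "sym_mats (Suc n) \<subseteq> ?b ` ?X"
    proof
      fix A :: "'a mat" assume "A \<in> sym_mats (Suc n)"
      then obtain a v B where "v \<in> carrier_mat n 1" "B \<in> sym_mats n" "A = bordered a v B"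
        by (rule sym_mats_Suc_cases)
      then show "A \<in> ?b ` ?X"
        by (intro image_eqI[of _ _ "(a, v, B)"]) auto
    qed
  qed
  ultimately have "(\<Sum>A\<in>sym_mats (Suc n). f A) = (\<Sum>x\<in>?X. f (?b x))"
    by (metis (no_types, lifting) sum.reindex_cong)
  also have "\<dots> = (\<Sum>(a, v, B)\<in>?X. f (bordered a v B))"
    by (intro sum.cong) auto
  finally show ?thesis
    by (simp add: sum.cartesian_product)
qed

lemma sum_sym_mats_0: "(\<Sum>A\<in>sym_mats 0. f A) = f (0\<^sub>m 0 0 :: 'a::zero mat)"
proof -
  have "sym_mats 0 = {0\<^sub>m 0 0 :: 'a mat}"
    by (auto simp: sym_mats_def intro!: eq_matI)
  then show ?thesis by simp
qed

text \<open>The one identity behind all eliminations below: Schur complements are the case \<open>a u = - v\<close>, and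
  the invariance of the determinant under adding \<open>u v\<^sup>T + v u\<^sup>T\<close> to the block is the case
  \<open>a = 0\<close>.\<close>
lemma bordered_congruence:
  fixes v :: "'a::comm_ring_1 mat"
  assumes u: "u \<in> carrier_mat n 1" and v: "v \<in> carrier_mat n 1" and B: "B \<in> carrier_mat n n"
  defines "L \<equiv> four_block_mat (1\<^sub>m 1) (0\<^sub>m 1 n) u (1\<^sub>m n)"
  shows "L * bordered a v B * transpose_mat L
    = bordered a (v + a \<cdot>\<^sub>m u) (B + cross u v + a \<cdot>\<^sub>m (u * transpose_mat u))"
proof -
  have Lt: "transpose_mat L = four_block_mat (1\<^sub>m 1) (transpose_mat u) (0\<^sub>m n 1) (1\<^sub>m n)"
    unfolding L_def using u by (subst transpose_four_block_mat[of _ 1 1 _ n _ n]) auto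
  have "L * bordered a v B
      = four_block_mat (a \<cdot>\<^sub>m 1\<^sub>m 1) (transpose_mat v) (a \<cdot>\<^sub>m u + v) (u * transpose_mat v + B)"
    unfolding L_def bordered_def using u v B
    by (subst mult_four_block_mat[of _ 1 1 _ n _ n _ _ 1 _ n])
      (auto simp: mult_smult_distrib[of _ n 1 _ 1] left_mult_one_mat[of _ 1 n])
  also have "\<dots> * transpose_mat L
      = four_block_mat (a \<cdot>\<^sub>m 1\<^sub>m 1) (a \<cdot>\<^sub>m transpose_mat u + transpose_mat v) (a \<cdot>\<^sub>m u + v)
          ((a \<cdot>\<^sub>m u + v) * transpose_mat u + (u * transpose_mat v + B))"
    unfolding Lt using u v B
    by (subst mult_four_block_mat[of _ 1 1 _ n _ n _ _ 1 _ n])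
      (auto simp: mult_smult_assoc_mat[of _ 1 1 _ n] right_mult_one_mat[of _ _ 1])
  also have "a \<cdot>\<^sub>m transpose_mat u + transpose_mat v = transpose_mat (v + a \<cdot>\<^sub>m u)"
    using u v by (intro eq_matI) (auto simp: add.commute)
  also have "a \<cdot>\<^sub>m u + v = v + a \<cdot>\<^sub>m u"
    using u v by (intro comm_add_mat) auto
  also have "(v + a \<cdot>\<^sub>m u) * transpose_mat u + (u * transpose_mat v + B)
      = B + cross u v + a \<cdot>\<^sub>m (u * transpose_mat u)"
    using u v B by (intro eq_matI) (auto simp: scalar_prod_def algebra_simps)
  finally show ?thesis
    by (simp add: bordered_def)
qed

lemma mat_trace_four_block:
  assumes "A \<in> carrier_mat 1 1" "D \<in> carrier_mat n n"
  shows "mat_trace (four_block_mat A B C D) = A $$ (0, 0) + mat_trace D"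
proof -
  have "mat_trace (four_block_mat A B C D) = (\<Sum>i<Suc n. four_block_mat A B C D $$ (i, i))"
    using assms by (simp add: mat_trace_def)
  also have "\<dots> = A $$ (0, 0) + (\<Sum>i<n. D $$ (i, i))"
    using assms by (subst sum.lessThan_Suc_shift) simp
  finally show ?thesis
    using assms by (simp add: mat_trace_def)
qed

lemma mat_trace_bordered:
  assumes v: "v \<in> carrier_mat n 1" and "B \<in> carrier_mat n n" "T \<in> carrier_mat n n"
  shows "mat_trace (bordered a v B * bordered t (0\<^sub>m n 1) T) = a * t + mat_trace (B * T)"
  unfolding bordered_def using assms
  by (subst mult_four_block_mat[of _ 1 1 _ n _ n _ _ 1 _ n])
    (auto simp: mat_trace_four_block[of _ _ n] scalar_prod_def)

lemma det_bordered_zero: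
  fixes B :: "'a::idom mat"
  assumes "B \<in> carrier_mat n n"
  shows "det (bordered a (0\<^sub>m n 1) B) = a * det B"
  unfolding bordered_def using assms
  by (subst det_four_block_mat_upper_right_zero[of _ 1 _ n]) auto

lemma det_bordered_shift:
  fixes B :: "'a::idom mat"
  assumes u: "u \<in> carrier_mat n 1" and v: "v \<in> carrier_mat n 1" and B: "B \<in> carrier_mat n n"
  shows "det (bordered a (v + a \<cdot>\<^sub>m u) (B + cross u v + a \<cdot>\<^sub>m (u * transpose_mat u)))
    = det (bordered a v B)"
proof -
  let ?L = "four_block_mat (1\<^sub>m 1) (0\<^sub>m 1 n) u (1\<^sub>m n)"
  have "det ?L = 1"
    using u by (subst det_four_block_mat_upper_right_zero[of _ 1 _ n]) auto
  moreover have "?L \<in> carrier_mat (Suc n) (Suc n)"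
    using u four_block_carrier_mat[of "1\<^sub>m 1" 1 1 "1\<^sub>m n" n n] by simp
  ultimately show ?thesis
    using bordered_congruence[OF u v B, of a] det_congruence[of ?L "Suc n" "bordered a v B"] B
    by simp
qed

text \<open>The Schur complement formula read backwards: the congruence with \<open>u = v / a\<close> turns the zero border
  into \<open>v\<close>.\<close>
lemma det_bordered_add_outer:
  fixes B :: "'a::field mat"
  assumes "a \<noteq> 0" and v: "v \<in> carrier_mat n 1" and B: "B \<in> carrier_mat n n"
  shows "det (bordered a v (B + inverse a \<cdot>\<^sub>m (v * transpose_mat v))) = a * det B"
proof -
  let ?u = "inverse a \<cdot>\<^sub>m v"
  have u: "?u \<in> carrier_mat n 1" using v by simp
  have "0\<^sub>m n 1 + a \<cdot>\<^sub>m ?u = v"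
    using assms by (intro eq_matI) auto
  moreover have "B + cross ?u (0\<^sub>m n 1) + a \<cdot>\<^sub>m (?u * transpose_mat ?u)
      = B + inverse a \<cdot>\<^sub>m (v * transpose_mat v)"
    using assms by (intro eq_matI) (auto simp: scalar_prod_def field_simps)
  ultimately show ?thesis
    using det_bordered_shift[OF u zero_carrier_mat B, of a] det_bordered_zero[OF B, of a] by simp
qed

lemma det_bordered_add_cross:
  fixes B :: "'a::idom mat"
  assumes u: "u \<in> carrier_mat n 1" and v: "v \<in> carrier_mat n 1" and B: "B \<in> carrier_mat n n"
  shows "det (bordered 0 v (B + cross u v)) = det (bordered 0 v B)"
proof -
  have "v + 0 \<cdot>\<^sub>m u = v" "B + cross u v + 0 \<cdot>\<^sub>m (u * transpose_mat u) = B + cross u v"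
    using assms by (intro eq_matI; auto)+
  then show ?thesis
    using det_bordered_shift[OF assms, of 0] by simp
qed

lemma nonzero_column_entry:
  assumes "v \<in> carrier_mat n 1" "v \<noteq> 0\<^sub>m n 1"
  obtains j where "j < n" "v $$ (j, 0) \<noteq> 0"
proof (rule ccontr)
  assume "\<not> thesis"
  then have "v = 0\<^sub>m n 1"
    using assms(1) that by (intro eq_matI) auto
  then show False using assms(2) by simp
qed

section \<open>Diagonalisation by congruences of determinant one\<close>

text \<open>If the corner is zero, the first row has another nonzero entry \<open>b\<close>, say in column \<open>j\<close>. Adding
  \<open>c\<close> times row and column \<open>j\<close> changes the corner to \<open>c\<^sup>2 T\<^sub>j\<^sub>j + 2 c b\<close>. A row addition is
  used instead of a permutation because it has determinant one.\<close>
lemma congruent_nonzero_corner: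
  fixes T :: "'a::field mat"
  assumes two: "(2::'a) \<noteq> 0" and T: "T \<in> sym_mats (Suc n)" and det: "det T \<noteq> 0"
  obtains R where "R \<in> carrier_mat (Suc n) (Suc n)" "det R = 1"
    "(R * T * transpose_mat R) $$ (0, 0) \<noteq> 0"
proof (cases "T $$ (0, 0) = 0")
  case False
  then show ?thesis
    using that[of "1\<^sub>m (Suc n)"] T by auto
next
  case True
  have Tc: "T \<in> carrier_mat (Suc n) (Suc n)" using T by auto
  obtain v B where vB: "v \<in> carrier_mat n 1" "B \<in> sym_mats n" "T = bordered 0 v B"
    using sym_mats_Suc_cases[OF T] True by metis
  have "v \<noteq> 0\<^sub>m n 1"
    using det det_bordered_zero[of B n 0] vB by auto
  then obtain j where j: "j < n" "v $$ (j, 0) \<noteq> 0"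
    using nonzero_column_entry[OF vB(1)] by metis
  define b where "b = T $$ (0, Suc j)"
  have b: "b \<noteq> 0"
    using j vB sym_mats_carrier[OF vB(2)] by (simp add: b_def bordered_def)
  \<comment> \<open>The index j counts positions in the border column, so it is row j + 1 of T.\<close>
  have corner: "(addrow_mat (Suc n) c 0 (Suc j) * T * transpose_mat (addrow_mat (Suc n) c 0 (Suc j)))
      $$ (0, 0) = c ^ 2 * T $$ (Suc j, Suc j) + 2 * c * b" for c
  proof -
    let ?R = "addrow_mat (Suc n) c 0 (Suc j)"
    have R: "?R \<in> carrier_mat (Suc n) (Suc n)" by simp
    have RX: "?R * X = addrow c 0 (Suc j) X" if "X \<in> carrier_mat (Suc n) (Suc n)" for X
      using addrow_mat[OF that, of "Suc j" c 0] j by simp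
    have "?R * T * transpose_mat ?R = transpose_mat (?R * transpose_mat (?R * T))"
      using transpose_mult[OF R, of "transpose_mat (?R * T)" "Suc n"] mult_carrier_mat[OF R Tc]
      by (simp only: transpose_carrier_mat transpose_transpose)
    then have "(?R * T * transpose_mat ?R) $$ (0, 0)
        = c * (c * T $$ (Suc j, Suc j) + T $$ (0, Suc j)) + (c * T $$ (Suc j, 0) + T $$ (0, 0))"
      using Tc j by (simp add: RX)
    then show ?thesis
      using True sym_mats_index[OF T, of "Suc j" 0] j
      by (simp add: b_def power2_eq_square algebra_simps)
  qed
  have det_R: "det (addrow_mat (Suc n) c 0 (Suc j)) = 1" for c :: 'a
    by (rule det_addrow_mat) simp
  \<comment> \<open>The values for c = 1 and c = -1 differ by four times b, so they are not both zero.\<close>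
  have "\<exists>c. c ^ 2 * T $$ (Suc j, Suc j) + 2 * c * b \<noteq> 0"
  proof (rule ccontr)
    assume "\<nexists>c. c ^ 2 * T $$ (Suc j, Suc j) + 2 * c * b \<noteq> 0"
    then have zero: "c ^ 2 * T $$ (Suc j, Suc j) + 2 * c * b = 0" for c by blast
    have "T $$ (Suc j, Suc j) = 2 * b"
      using zero[of "- 1"] by simp
    then have "2 * b + 2 * b = 0"
      using zero[of 1] by simp
    then have "2 * (2 * b) = 0"
      by (simp only: mult_2)
    then show False
      using two b by (metis mult_eq_0_iff)
  qed
  then obtain c where "c ^ 2 * T $$ (Suc j, Suc j) + 2 * c * b \<noteq> 0" by blast
  then show ?thesis
    using that[of "addrow_mat (Suc n) c 0 (Suc j)"] corner det_R by auto
qed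

text \<open>Once the corner is nonzero, completing the square removes the border.\<close>
lemma congruent_bordered_zero:
  fixes T :: "'a::field mat"
  assumes two: "(2::'a) \<noteq> 0" and T: "T \<in> sym_mats (Suc n)" and det: "det T \<noteq> 0"
  obtains P t T' where "P \<in> carrier_mat (Suc n) (Suc n)" "det P = 1"
    "P * T * transpose_mat P = bordered t (0\<^sub>m n 1) T'" "t \<noteq> 0" "T' \<in> sym_mats n" "det T' \<noteq> 0"
proof -
  have Tc: "T \<in> carrier_mat (Suc n) (Suc n)" using T by auto
  obtain R where R: "R \<in> carrier_mat (Suc n) (Suc n)" "det R = 1"
    "(R * T * transpose_mat R) $$ (0, 0) \<noteq> 0"
    by (rule congruent_nonzero_corner[OF assms])
  let ?S = "R * T * transpose_mat R"
  have S: "?S \<in> sym_mats (Suc n)"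
    using sym_mats_congruence R(1) T by blast
  then obtain t v B where vB: "v \<in> carrier_mat n 1" "B \<in> sym_mats n" "?S = bordered t v B"
    "t = ?S $$ (0, 0)"
    by (rule sym_mats_Suc_cases)
  have t: "t \<noteq> 0" using R(3) vB(4) by simp
  have B: "B \<in> carrier_mat n n" using vB(2) by auto
  define u where "u = - inverse t \<cdot>\<^sub>m v"
  have u: "u \<in> carrier_mat n 1" using vB(1) by (simp add: u_def)
  let ?L = "four_block_mat (1\<^sub>m 1) (0\<^sub>m 1 n) u (1\<^sub>m n)"
  have L: "?L \<in> carrier_mat (Suc n) (Suc n)"
    using four_block_carrier_mat[of "1\<^sub>m 1" 1 1 "1\<^sub>m n" n n] by simp
  have det_L: "det ?L = 1"
    using u by (subst det_four_block_mat_upper_right_zero[of _ 1 _ n]) auto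
  let ?C = "B + cross u v + t \<cdot>\<^sub>m (u * transpose_mat u)"
  have "v + t \<cdot>\<^sub>m u = 0\<^sub>m n 1"
    using vB(1) t by (intro eq_matI) (auto simp: u_def)
  then have LSL: "?L * ?S * transpose_mat ?L = bordered t (0\<^sub>m n 1) ?C"
    using bordered_congruence[OF u vB(1) B, of t] vB(3) by simp
  have C: "?C \<in> carrier_mat n n" using u vB(1) B by auto
  have "transpose_mat ?C = ?C"
    using u vB(1) sym_mats_index[OF vB(2)] B
    by (intro eq_matI) (auto simp: scalar_prod_def mult.commute add.commute)
  then have Csym: "?C \<in> sym_mats n" using C by (simp add: sym_mats_def)
  have LR: "?L * R \<in> carrier_mat (Suc n) (Suc n)" using L R by simp
  have "(?L * R) * T * transpose_mat (?L * R) = ?L * ?S * transpose_mat ?L"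
    using L R(1) Tc transpose_mult[OF L R(1)]
    by (simp add: assoc_mult_mat[of _ "Suc n" "Suc n" _ "Suc n" _ "Suc n"])
  then have eq: "(?L * R) * T * transpose_mat (?L * R) = bordered t (0\<^sub>m n 1) ?C"
    using LSL by simp
  have det_LR: "det (?L * R) = 1"
    using det_mult[OF L R(1)] det_L R(2) by simp
  have "t * det ?C = det T"
    using det_bordered_zero[OF C, of t] det_congruence[OF LR Tc] eq det_LR by simp
  then have "det ?C \<noteq> 0" using det by auto
  then show ?thesis
    using that[OF LR det_LR eq t Csym] by simp
qed

text \<open>Diagonalisation in the form of an induction principle: a property that can be pulled back along
  congruences of determinant one need only be checked on diagonal matrices, one entry at a time.\<close>
lemma invertible_symmetric_induct [consumes 3, case_names empty bordered congruent]:
  fixes T :: "'a::field mat"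
  assumes "(2::'a) \<noteq> 0" "T \<in> sym_mats n" "det T \<noteq> 0"
    and "Q 0 (0\<^sub>m 0 0)"
    and bordered: "\<And>n t T. t \<noteq> 0 \<Longrightarrow> T \<in> sym_mats n \<Longrightarrow> det T \<noteq> 0 \<Longrightarrow> Q n T
      \<Longrightarrow> Q (Suc n) (bordered t (0\<^sub>m n 1) T)"
    and congruent: "\<And>n P T. P \<in> carrier_mat n n \<Longrightarrow> det P = 1 \<Longrightarrow> T \<in> sym_mats n
      \<Longrightarrow> Q n (P * T * transpose_mat P) \<Longrightarrow> Q n T"
  shows "Q n T"
  using assms(2,3)
proof (induction n arbitrary: T)
  case 0
  then have "T = 0\<^sub>m 0 0" by (intro eq_matI) auto
  then show ?case using assms(4) by simp
next
  case (Suc n)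
  obtain P t T' where P: "P \<in> carrier_mat (Suc n) (Suc n)" "det P = 1"
    "P * T * transpose_mat P = bordered t (0\<^sub>m n 1) T'" "t \<noteq> 0" "T' \<in> sym_mats n" "det T' \<noteq> 0"
    by (rule congruent_bordered_zero[OF assms(1) Suc.prems])
  then have "Q (Suc n) (P * T * transpose_mat P)"
    using bordered Suc.IH by simp
  then show ?case
    using congruent P(1,2) Suc.prems(1) by blast
qed

section \<open>Matrix Gauss sums with a nontrivial additive character\<close>

lemma sum_carrier_mat_Suc_1:
  fixes f :: "'a::{comm_ring_1,finite} mat \<Rightarrow> complex"
  shows "(\<Sum>v\<in>carrier_mat (Suc n) 1. f v)
    = (\<Sum>x\<in>UNIV. \<Sum>v\<in>carrier_mat n 1. f (mat (Suc n) 1 (\<lambda>(i, _). case i of 0 \<Rightarrow> x | Suc i \<Rightarrow> v $$ (i, 0))))"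
  unfolding sum.cartesian_product
  by (rule sum.reindex_bij_witness[where
        i = "\<lambda>(x, v). mat (Suc n) 1 (\<lambda>(i, _). case i of 0 \<Rightarrow> x | Suc i \<Rightarrow> v $$ (i, 0))" and
        j = "\<lambda>v. (v $$ (0, 0), mat n 1 (\<lambda>(i, _). v $$ (Suc i, 0)))"])
    (auto intro!: eq_matI arg_cong[of _ _ f] split: nat.splits)

lemma sum_sym_mats_translate:
  fixes f :: "'a::comm_ring_1 mat \<Rightarrow> complex"
  assumes C: "C \<in> sym_mats n"
  shows "(\<Sum>B\<in>sym_mats n. f (B + C)) = (\<Sum>B\<in>sym_mats n. f B)"
proof (rule sum.reindex_bij_witness[of _ "\<lambda>B. B - C" "\<lambda>B. B + C"])
  fix B :: "'a mat" assume B: "B \<in> sym_mats n"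
  have c: "B \<in> carrier_mat n n" "C \<in> carrier_mat n n" using B C by auto
  show "B + C - C = B" "B - C + C = B"
    using c by (intro eq_matI; auto)+
  show "B + C \<in> sym_mats n" "B - C \<in> sym_mats n"
    using c sym_mats_transpose[OF B] sym_mats_transpose[OF C]
    by (auto intro!: sym_matsI simp: transpose_add[of _ n n] transpose_minus[of _ n n])
qed simp

lemma outer_sym: "v \<in> carrier_mat n 1 \<Longrightarrow> v * transpose_mat v \<in> sym_mats n"
  for v :: "'a::comm_ring_1 mat"
  by (rule sym_matsI) (auto simp: transpose_mult[of _ n 1 _ n])

lemma smult_sym: "A \<in> sym_mats n \<Longrightarrow> c \<cdot>\<^sub>m A \<in> sym_mats n"
  unfolding sym_mats_def by (auto intro!: eq_matI) (metis carrier_matD index_transpose_mat(1))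

lemma cross_sym:
  fixes u v :: "'a::comm_ring_1 mat"
  assumes "u \<in> carrier_mat n 1" "v \<in> carrier_mat n 1"
  shows "cross u v \<in> sym_mats n"
  using assms
  by (intro sym_matsI) (auto intro!: eq_matI simp: scalar_prod_def mult.commute add.commute)

text \<open>The trace equals \<open>2 u\<^sup>T T v\<close>, a nonzero linear form in \<open>u\<close> because \<open>T v \<noteq> 0\<close>; a suitable
  multiple of a unit vector attains the value \<open>b\<close>.\<close>
lemma exists_cross_trace:
  fixes T :: "'a::field mat"
  assumes two: "(2::'a) \<noteq> 0" and T: "T \<in> sym_mats n" "det T \<noteq> 0"
    and v: "v \<in> carrier_mat n 1" "v \<noteq> 0\<^sub>m n 1"
  obtains u where "u \<in> carrier_mat n 1" "mat_trace (cross u v * T) = b"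
proof -
  have Tc: "T \<in> carrier_mat n n" using T(1) by auto
  obtain Q where Q: "Q \<in> carrier_mat n n" "Q * T = 1\<^sub>m n"
    using obtain_inverse[OF Tc T(2)] by metis
  have w: "T * v \<in> carrier_mat n 1" using Tc v by simp
  have "T * v \<noteq> 0\<^sub>m n 1"
  proof
    assume "T * v = 0\<^sub>m n 1"
    then have "v = Q * 0\<^sub>m n 1"
      using assoc_mult_mat[OF Q(1) Tc v(1)] Q(2) v(1) by simp
    then show False using v(2) Q(1) by simp
  qed
  then obtain j where j: "j < n" "(T * v) $$ (j, 0) \<noteq> 0"
    using nonzero_column_entry[OF w] by metis
  define u where "u = mat n 1 (\<lambda>(i, _). if i = j then b / (2 * (T * v) $$ (j, 0)) else 0)"
  have u: "u \<in> carrier_mat n 1" by (simp add: u_def)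
  have ut: "transpose_mat u \<in> carrier_mat 1 n" using u by simp
  have vt: "transpose_mat v \<in> carrier_mat 1 n" using v by simp
  have uv: "u * transpose_mat v \<in> carrier_mat n n" "v * transpose_mat u \<in> carrier_mat n n"
    using u v by auto
  have "mat_trace (v * transpose_mat u * T) = mat_trace (T * (v * transpose_mat u))"
    using uv Tc by (intro mat_trace_comm[of _ n n]) auto
  also have "\<dots> = mat_trace (T * v * transpose_mat u)"
    using assoc_mult_mat[OF Tc v(1) ut] by simp
  also have "\<dots> = mat_trace (transpose_mat u * (T * v))"
    by (rule mat_trace_comm[OF w ut])
  finally have 1: "mat_trace (v * transpose_mat u * T) = mat_trace (transpose_mat u * (T * v))" .
  have "mat_trace (u * transpose_mat v * T) = mat_trace (transpose_mat (u * transpose_mat v * T))"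
    using uv Tc by (intro mat_trace_transpose[symmetric, of _ n]) auto
  also have "transpose_mat (u * transpose_mat v * T) = T * (v * transpose_mat u)"
    using transpose_mult[OF uv(1) Tc] transpose_mult[OF u vt] sym_mats_transpose[OF T(1)] by simp
  also have "mat_trace \<dots> = mat_trace (v * transpose_mat u * T)"
    using uv Tc by (intro mat_trace_comm[of _ n n]) auto
  finally have 2: "mat_trace (u * transpose_mat v * T) = mat_trace (v * transpose_mat u * T)" .
  have "mat_trace (cross u v * T) = mat_trace (u * transpose_mat v * T) + mat_trace (v * transpose_mat u * T)"
    using add_mult_distrib_mat[OF uv Tc] mat_trace_add[of "u * transpose_mat v * T" n] uv Tc by simp
  also have "\<dots> = 2 * mat_trace (transpose_mat u * (T * v))"
    using 1 2 by simp
  also have "mat_trace (transpose_mat u * (T * v)) = (\<Sum>i<n. u $$ (i, 0) * (T * v) $$ (i, 0))"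
    using u mat_trace_mult[OF ut w] by (simp del: index_mult_mat)
  also have "\<dots> = (\<Sum>i<n. if i = j then b / 2 else 0)"
    using j two by (intro sum.cong) (auto simp: u_def simp del: index_mult_mat)
  also have "\<dots> = b / 2" using j by simp
  finally have "mat_trace (cross u v * T) = b" using two by simp
  then show ?thesis using that u by blast
qed

text \<open>The same sum as \<open>sym_gauss_sum\<close>, but over all symmetric matrices; the additional terms vanish
  for a multiplicative character. The larger index set is a product set in corner, border and
  block.\<close>
definition sym_sum :: "nat \<Rightarrow> ('a::{field,finite} \<Rightarrow> complex) \<Rightarrow> ('a \<Rightarrow> complex) \<Rightarrow> 'a mat \<Rightarrow> complex"
  where "sym_sum n \<omega> \<psi> T = (\<Sum>A\<in>sym_mats n. \<omega> (det A) * \<psi> (mat_trace (A * T)))"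

lemma (in mult_char) sym_gauss_sum_eq: "sym_gauss_sum n \<omega> \<psi> T = sym_sum n \<omega> \<psi> T"
  unfolding sym_gauss_sum_def sym_sum_def invertible_symmetric_mats_eq
  by (intro sum.mono_neutral_left) auto

lemma sym_sum_congruence:
  assumes P: "P \<in> carrier_mat n n" "det P = 1" and T: "T \<in> carrier_mat n n"
  shows "sym_sum n \<omega> \<psi> (P * T * transpose_mat P) = sym_sum n \<omega> \<psi> T"
proof -
  let ?Q = "transpose_mat P"
  have Q: "?Q \<in> carrier_mat n n" "det ?Q = 1" using P by (auto simp: det_transpose)
  have "sym_sum n \<omega> \<psi> T = (\<Sum>A\<in>sym_mats n. \<omega> (det (?Q * A * transpose_mat ?Q))
      * \<psi> (mat_trace (?Q * A * transpose_mat ?Q * T)))"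
    unfolding sym_sum_def
    by (rule sum.reindex_bij_betw[symmetric]) (rule bij_betw_congruence, use Q in auto)
  also have "\<dots> = sym_sum n \<omega> \<psi> (P * T * transpose_mat P)"
    unfolding sym_sum_def
  proof (intro sum.cong refl)
    fix A :: "'a mat" assume "A \<in> sym_mats n"
    then have A: "A \<in> carrier_mat n n" by auto
    show "\<omega> (det (?Q * A * transpose_mat ?Q)) * \<psi> (mat_trace (?Q * A * transpose_mat ?Q * T))
        = \<omega> (det A) * \<psi> (mat_trace (A * (P * T * transpose_mat P)))"
      using det_congruence[OF Q(1) A] Q(2) mat_trace_congruence[OF P(1) A T] by simp
  qed
  finally show ?thesis by simp
qed

context quadratic_gauss
begin

text \<open>The quadratic form \<open>v\<^sup>T T v\<close> is written as \<open>tr (v v\<^sup>T T)\<close>, the shape in which it arises from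
  the Schur complement. For diagonal \<open>T\<close> the sum is a product of one-dimensional quadratic sums.\<close>
lemma sum_quadratic_form:
  assumes "T \<in> sym_mats n" "det T \<noteq> 0"
  shows "(\<Sum>v\<in>carrier_mat n 1. \<psi> (mat_trace (v * transpose_mat v * T))) = \<chi> (det T) * G ^ n"
  using two_nonzero assms
proof (induction rule: invertible_symmetric_induct)
  case empty
  have "carrier_mat 0 1 = {0\<^sub>m 0 1 :: 'a mat}" by (auto intro!: eq_matI)
  then show ?case by (simp add: mat_trace_def)
next
  case (bordered n t T)
  have T: "T \<in> carrier_mat n n" using bordered by auto
  let ?c = "\<lambda>x v. mat (Suc n) 1 (\<lambda>(i, _). case i of 0 \<Rightarrow> x | Suc i \<Rightarrow> v $$ (i, 0))"
  have square_column: "?c x v * transpose_mat (?c x v) = bordered (x ^ 2) (x \<cdot>\<^sub>m v) (v * transpose_mat v)"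
    if "v \<in> carrier_mat n 1" for x :: 'a and v
    using that by (intro eq_matI)
      (auto simp: bordered_def scalar_prod_def power2_eq_square mult.commute split: nat.splits)
  have summand: "\<psi> (mat_trace (?c x v * transpose_mat (?c x v) * bordered t (0\<^sub>m n 1) T))
      = \<psi> (x ^ 2 * t) * \<psi> (mat_trace (v * transpose_mat v * T))"
    if v: "v \<in> carrier_mat n 1" for x v
  proof -
    have "mat_trace (bordered (x ^ 2) (x \<cdot>\<^sub>m v) (v * transpose_mat v) * bordered t (0\<^sub>m n 1) T)
        = x ^ 2 * t + mat_trace (v * transpose_mat v * T)"
      using v T by (intro mat_trace_bordered) auto
    then show ?thesis
      by (simp only: square_column[OF v] add)
  qed
  have "(\<Sum>v\<in>carrier_mat (Suc n) 1. \<psi> (mat_trace (v * transpose_mat v * bordered t (0\<^sub>m n 1) T)))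
      = (\<Sum>x\<in>UNIV. \<psi> (x ^ 2 * t)) * (\<Sum>v\<in>carrier_mat n 1. \<psi> (mat_trace (v * transpose_mat v * T)))"
    unfolding sum_carrier_mat_Suc_1 sum_product by (intro sum.cong refl summand)
  also have "\<dots> = (\<chi> t * G) * (\<chi> (det T) * G ^ n)"
    by (simp only: sum_square_mult[OF bordered(1)] bordered.IH)
  finally show ?case
    by (simp only: det_bordered_zero[OF T] mult power_Suc mult_ac)
next
  case (congruent n P T)
  have T: "T \<in> carrier_mat n n" using congruent by auto
  note P = congruent(1,2)
  have "(\<Sum>v\<in>carrier_mat n 1. \<psi> (mat_trace (v * transpose_mat v * T)))
      = (\<Sum>v\<in>carrier_mat n 1. \<psi> (mat_trace ((transpose_mat P * v) * transpose_mat (transpose_mat P * v) * T)))"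
    by (rule sum.reindex_bij_betw[symmetric]) (rule bij_betw_mult_left, use P in \<open>auto simp: det_transpose\<close>)
  also have "\<dots> = (\<Sum>v\<in>carrier_mat n 1. \<psi> (mat_trace (v * transpose_mat v * (P * T * transpose_mat P))))"
  proof (intro sum.cong refl)
    fix v :: "'a mat" assume v: "v \<in> carrier_mat n 1"
    have "transpose_mat (transpose_mat P * v) = transpose_mat v * P"
      using transpose_mult[of "transpose_mat P" n n v 1] P v by simp
    then have "(transpose_mat P * v) * transpose_mat (transpose_mat P * v)
        = (transpose_mat P * v) * (transpose_mat v * P)" by simp
    also have "\<dots> = transpose_mat P * (v * (transpose_mat v * P))"
      using P v by (intro assoc_mult_mat[of _ n n _ 1 _ n]) auto
    also have "v * (transpose_mat v * P) = v * transpose_mat v * P"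
      using P v by (intro assoc_mult_mat[symmetric, of _ n 1 _ n _ n]) auto
    also have "transpose_mat P * \<dots> = transpose_mat P * (v * transpose_mat v) * P"
      using P v by (intro assoc_mult_mat[symmetric, of _ n n _ n _ n]) auto
    finally show "\<psi> (mat_trace ((transpose_mat P * v) * transpose_mat (transpose_mat P * v) * T))
        = \<psi> (mat_trace (v * transpose_mat v * (P * T * transpose_mat P)))"
      using mat_trace_congruence[OF P(1) _ T, of "v * transpose_mat v"] v by simp
  qed
  finally show ?case
    using congruent det_congruence[OF P(1) T] by simp
qed

text \<open>The recursion step. Only corners \<open>a \<noteq> 0\<close> contribute; each gives \<open>\<omega> a\<close> from the determinant,
  \<open>\<chi> a ^ n\<close> from the quadratic form \<open>v\<^sup>T T v / a\<close> in the border and \<open>\<psi> (a t)\<close> from the trace,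
  which together form a one-dimensional Gauss sum dilated by \<open>t\<close>.\<close>
lemma sym_sum_bordered:
  assumes w: "mult_character \<omega>" and t: "t \<noteq> 0" and T: "T \<in> sym_mats n" "det T \<noteq> 0"
  shows "sym_sum (Suc n) \<omega> \<psi> (bordered t (0\<^sub>m n 1) T)
    = gauss_sum (\<lambda>a. \<omega> a * \<chi> a ^ n) \<psi> / (\<omega> t * \<chi> t ^ n) * \<chi> (det T) * G ^ n * sym_sum n \<omega> \<psi> T"
proof -
  interpret w: mult_char \<omega> by unfold_locales fact
  have Tc: "T \<in> carrier_mat n n" using T by auto
  \<comment> \<open>For \<open>v \<noteq> 0\<close> a translation of B leaves the determinant alone and multiplies the sum by a
    value of \<open>\<psi>\<close> other than 1.\<close>
  have corner_zero: "(\<Sum>B\<in>sym_mats n. \<omega> (det (bordered 0 v B)) * \<psi> (mat_trace (B * T))) = 0"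
    if v: "v \<in> carrier_mat n 1" for v
  proof (cases "v = 0\<^sub>m n 1")
    case True
    have "det (bordered 0 (0\<^sub>m n 1) B) = 0" if "B \<in> sym_mats n" for B :: "'a mat"
      using det_bordered_zero[of B n 0] that by auto
    then show ?thesis using True by simp
  next
    case False
    let ?s = "\<Sum>B\<in>sym_mats n. \<omega> (det (bordered 0 v B)) * \<psi> (mat_trace (B * T))"
    obtain b where b: "\<psi> b \<noteq> 1" by (rule nontrivial_value)
    obtain u where u: "u \<in> carrier_mat n 1" "mat_trace (cross u v * T) = b"
      by (rule exists_cross_trace[OF two_nonzero T v False])
    have "?s = (\<Sum>B\<in>sym_mats n. \<omega> (det (bordered 0 v (B + cross u v))) * \<psi> (mat_trace ((B + cross u v) * T)))"
      by (rule sum_sym_mats_translate[symmetric, OF cross_sym[OF u(1) v]])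
    also have "\<dots> = (\<Sum>B\<in>sym_mats n. \<psi> b * (\<omega> (det (bordered 0 v B)) * \<psi> (mat_trace (B * T))))"
    proof (intro sum.cong refl)
      fix B :: "'a mat" assume "B \<in> sym_mats n"
      then have B: "B \<in> carrier_mat n n" by auto
      have c: "cross u v \<in> carrier_mat n n" using u v by auto
      have "mat_trace ((B + cross u v) * T) = mat_trace (B * T) + b"
        using add_mult_distrib_mat[OF B c Tc] mat_trace_add[of "B * T" n "cross u v * T"] B c Tc u(2)
        by simp
      then show "\<omega> (det (bordered 0 v (B + cross u v))) * \<psi> (mat_trace ((B + cross u v) * T))
          = \<psi> b * (\<omega> (det (bordered 0 v B)) * \<psi> (mat_trace (B * T)))"
        by (simp add: det_bordered_add_cross[OF u(1) v B] add)
    qed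
    also have "\<dots> = \<psi> b * ?s" by (simp add: sum_distrib_left)
    finally show ?thesis using b by simp
  qed
  have corner_nonzero: "(\<Sum>B\<in>sym_mats n. \<omega> (det (bordered a v B)) * \<psi> (mat_trace (B * T)))
      = \<omega> a * sym_sum n \<omega> \<psi> T * \<psi> (mat_trace (v * transpose_mat v * (inverse a \<cdot>\<^sub>m T)))"
    if a: "a \<noteq> 0" and v: "v \<in> carrier_mat n 1" for a v
  proof -
    let ?C = "inverse a \<cdot>\<^sub>m (v * transpose_mat v)"
    have C: "?C \<in> sym_mats n" by (intro smult_sym outer_sym v)
    have Cc: "?C \<in> carrier_mat n n" using v by auto
    have CT: "?C * T = v * transpose_mat v * (inverse a \<cdot>\<^sub>m T)"
      using v Tc mult_smult_assoc_mat[of "v * transpose_mat v" n n T n "inverse a"]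
        mult_smult_distrib[of "v * transpose_mat v" n n T n "inverse a"] by simp
    have "(\<Sum>B\<in>sym_mats n. \<omega> (det (bordered a v B)) * \<psi> (mat_trace (B * T)))
        = (\<Sum>B\<in>sym_mats n. \<omega> (det (bordered a v (B + ?C))) * \<psi> (mat_trace ((B + ?C) * T)))"
      by (rule sum_sym_mats_translate[symmetric, OF C])
    also have "\<dots> = (\<Sum>B\<in>sym_mats n. \<omega> a * (\<omega> (det B) * \<psi> (mat_trace (B * T))) * \<psi> (mat_trace (?C * T)))"
    proof (intro sum.cong refl)
      fix B :: "'a mat" assume "B \<in> sym_mats n"
      then have B: "B \<in> carrier_mat n n" by auto
      have "mat_trace ((B + ?C) * T) = mat_trace (B * T) + mat_trace (?C * T)"
        using add_mult_distrib_mat[OF B Cc Tc] mat_trace_add[of "B * T" n "?C * T"] B Cc Tc by simp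
      then show "\<omega> (det (bordered a v (B + ?C))) * \<psi> (mat_trace ((B + ?C) * T))
          = \<omega> a * (\<omega> (det B) * \<psi> (mat_trace (B * T))) * \<psi> (mat_trace (?C * T))"
        using det_bordered_add_outer[OF a v B] by (simp add: add w.mult)
    qed
    also have "\<dots> = \<omega> a * sym_sum n \<omega> \<psi> T * \<psi> (mat_trace (?C * T))"
      unfolding sym_sum_def by (simp only: sum_distrib_left sum_distrib_right)
    finally show ?thesis by (simp only: CT)
  qed
  have inner: "(\<Sum>v\<in>carrier_mat n 1. \<Sum>B\<in>sym_mats n. \<omega> (det (bordered a v B)) * \<psi> (mat_trace (B * T)))
      = \<omega> a * \<chi> a ^ n * (\<chi> (det T) * G ^ n * sym_sum n \<omega> \<psi> T)" for a
  proof (cases "a = 0")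
    case True
    then show ?thesis using corner_zero by simp
  next
    case False
    have "\<chi> (inverse a) = \<chi> a"
      using value_cases[OF False] by (auto simp: inverse)
    then have "\<chi> (det (inverse a \<cdot>\<^sub>m T)) = \<chi> a ^ n * \<chi> (det T)"
      using Tc by (simp add: mult power)
    moreover have "det (inverse a \<cdot>\<^sub>m T) \<noteq> 0"
      using T(2) False by simp
    ultimately have "(\<Sum>v\<in>carrier_mat n 1. \<psi> (mat_trace (v * transpose_mat v * (inverse a \<cdot>\<^sub>m T))))
        = \<chi> a ^ n * \<chi> (det T) * G ^ n"
      using sum_quadratic_form[of "inverse a \<cdot>\<^sub>m T" n] smult_sym[OF T(1)] by simp
    then show ?thesis
      using corner_nonzero[OF False] by (simp flip: sum_distrib_left)
  qed
  have "sym_sum (Suc n) \<omega> \<psi> (bordered t (0\<^sub>m n 1) T)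
      = (\<Sum>a\<in>UNIV. \<Sum>v\<in>carrier_mat n 1. \<Sum>B\<in>sym_mats n.
          \<psi> (a * t) * (\<omega> (det (bordered a v B)) * \<psi> (mat_trace (B * T))))"
    unfolding sym_sum_def sum_sym_mats_Suc
  proof (intro sum.cong refl)
    fix a :: 'a and v B :: "'a mat" assume "v \<in> carrier_mat n 1" "B \<in> sym_mats n"
    then show "\<omega> (det (bordered a v B)) * \<psi> (mat_trace (bordered a v B * bordered t (0\<^sub>m n 1) T))
        = \<psi> (a * t) * (\<omega> (det (bordered a v B)) * \<psi> (mat_trace (B * T)))"
      using Tc mat_trace_bordered[of v n B T a t] sym_mats_carrier[of B n] by (simp add: add)
  qed
  also have "\<dots> = (\<Sum>a\<in>UNIV. \<psi> (a * t) * (\<Sum>v\<in>carrier_mat n 1. \<Sum>B\<in>sym_mats n.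
      \<omega> (det (bordered a v B)) * \<psi> (mat_trace (B * T))))"
    by (simp only: sum_distrib_left)
  also have "\<dots> = (\<Sum>a\<in>UNIV. \<omega> a * \<chi> a ^ n * \<psi> (a * t)) * (\<chi> (det T) * G ^ n * sym_sum n \<omega> \<psi> T)"
    unfolding inner sum_distrib_right by (intro sum.cong refl) (simp only: mult_ac)
  also have "(\<Sum>a\<in>UNIV. \<omega> a * \<chi> a ^ n * \<psi> (a * t))
      = gauss_sum (\<lambda>a. \<omega> a * \<chi> a ^ n) \<psi> / (\<omega> t * \<chi> t ^ n)"
    by (rule gauss_sum_dilate[OF mult_character_times_power[OF w mult_character] t])
  finally show ?thesis by (simp add: mult_ac)
qed

text \<open>Each diagonal entry \<open>t\<close> collects \<open>1 / \<omega> t\<close> and, from its own step and from the determinants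
  of the later blocks, \<open>n - 1\<close> factors \<open>\<chi> t\<close>; the exponent \<open>n + 1\<close> below has the same parity.\<close>
lemma sym_sum_eq:
  assumes w: "mult_character \<omega>" and "T \<in> sym_mats n" "det T \<noteq> 0"
  shows "sym_sum n \<omega> \<psi> T
    = (\<Prod>k<n. gauss_sum (\<lambda>a. \<omega> a * \<chi> a ^ k) \<psi> * G ^ k) * \<chi> (det T) ^ Suc n / \<omega> (det T)"
  using two_nonzero assms(2,3)
proof (induction rule: invertible_symmetric_induct)
  case empty
  interpret w: mult_char \<omega> by unfold_locales fact
  show ?case by (simp add: sym_sum_def sum_sym_mats_0 mat_trace_def)
next
  case (bordered n t T)
  interpret w: mult_char \<omega> by unfold_locales fact
  have T: "T \<in> carrier_mat n n" using bordered by auto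
  let ?g = "gauss_sum (\<lambda>a. \<omega> a * \<chi> a ^ n) \<psi>"
  let ?p = "\<Prod>k<n. gauss_sum (\<lambda>a. \<omega> a * \<chi> a ^ k) \<psi> * G ^ k"
  have t: "1 / \<chi> t ^ n = \<chi> t ^ Suc (Suc n)"
    using value_cases[OF bordered(1)] by (auto simp: power_minus_odd uminus_power_if)
  have "sym_sum (Suc n) \<omega> \<psi> (bordered t (0\<^sub>m n 1) T)
      = ?g / (\<omega> t * \<chi> t ^ n) * \<chi> (det T) * G ^ n * (?p * \<chi> (det T) ^ Suc n / \<omega> (det T))"
    using sym_sum_bordered[OF w bordered(1-3)] bordered.IH by simp
  also have "\<dots> = ?p * (?g * G ^ n) * ((1 / \<chi> t ^ n) * \<chi> (det T) ^ Suc (Suc n)) / (\<omega> t * \<omega> (det T))"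
    by (simp add: field_simps)
  also have "\<dots> = ?p * (?g * G ^ n) * (\<chi> t * \<chi> (det T)) ^ Suc (Suc n) / (\<omega> t * \<omega> (det T))"
    unfolding t power_mult_distrib by simp
  finally show ?case
    by (simp only: det_bordered_zero[OF T] mult w.mult prod.lessThan_Suc)
next
  case (congruent n P T)
  have T: "T \<in> carrier_mat n n" using congruent by auto
  show ?case
    using congruent sym_sum_congruence[OF congruent(1,2) T] det_congruence[OF congruent(1) T] by simp
qed

text \<open>Consecutive factors pair up, \<open>\<chi> ^ k\<close> being 1 or \<open>\<chi>\<close> according to the parity of \<open>k\<close>, and each
  pair is evaluated by the duplication formula.\<close>
lemma prod_gauss_sums_even:
  assumes w: "mult_character \<omega>"
  shows "(\<Prod>k<2 * m. gauss_sum (\<lambda>a. \<omega> a * \<chi> a ^ k) \<psi> * G ^ k)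
    = (gauss_sum (\<lambda>a. \<omega> a ^ 2) \<psi> / \<omega> 4) ^ m * (G ^ 2) ^ (m ^ 2)"
proof (induction m)
  case (Suc m)
  interpret w: mult_char \<omega> by unfold_locales fact
  have chi: "\<omega> a * \<chi> a ^ (2 * m) = \<omega> a" "\<omega> a * \<chi> a ^ Suc (2 * m) = \<omega> a * \<chi> a" for a
    using square[of a] by (cases "a = 0"; simp add: power_mult)+
  let ?h = "gauss_sum (\<lambda>a. \<omega> a ^ 2) \<psi> / \<omega> 4"
  have "(\<Prod>k<2 * Suc m. gauss_sum (\<lambda>a. \<omega> a * \<chi> a ^ k) \<psi> * G ^ k)
      = ?h ^ m * (G ^ 2) ^ (m ^ 2) * (gauss_sum \<omega> \<psi> * gauss_sum (\<lambda>a. \<omega> a * \<chi> a) \<psi>)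
        * (G ^ (2 * m) * G ^ Suc (2 * m))"
    using Suc by (simp only: mult_Suc_right add_2_eq_Suc prod.lessThan_Suc chi) (simp only: mult_ac)
  also have "\<dots> = ?h ^ Suc m * ((G ^ 2) ^ (m ^ 2) * (G * G ^ (2 * m) * G ^ Suc (2 * m)))"
    by (simp only: gauss_sum_duplication[OF w]) (simp add: mult_ac)
  also have "(G ^ 2) ^ (m ^ 2) * (G * G ^ (2 * m) * G ^ Suc (2 * m)) = (G ^ 2) ^ (Suc m ^ 2)"
  proof -
    have "(G ^ 2) ^ (m ^ 2) * (G * G ^ (2 * m) * G ^ Suc (2 * m))
        = G ^ (2 * m ^ 2 + (Suc (2 * m) + Suc (2 * m)))"
      by (simp only: power_mult power_add power_Suc)
    also have "2 * m ^ 2 + (Suc (2 * m) + Suc (2 * m)) = 2 * Suc m ^ 2"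
      by (simp add: power2_eq_square algebra_simps)
    finally show ?thesis by (simp only: power_mult)
  qed
  finally show ?case .
qed simp

lemma sym_sum_even:
  assumes w: "mult_character \<omega>" and T: "T \<in> sym_mats (2 * m)" "det T \<noteq> 0"
  shows "sym_sum (2 * m) \<omega> \<psi> T
    = \<chi> (- 1) ^ m * \<chi> (det T) * of_nat CARD('a) ^ (m\<^sup>2) / \<omega> (4 ^ m * det T)
      * gauss_sum (\<lambda>a. \<omega> a ^ 2) \<psi> ^ m"
proof -
  interpret w: mult_char \<omega> by unfold_locales fact
  have "\<chi> (det T) ^ Suc (2 * m) = \<chi> (det T)"
    using square[OF T(2)] by (simp add: power_mult)
  moreover have "(\<chi> (- 1)) ^ (m ^ 2) = \<chi> (- 1) ^ m"
    using value_cases[of "- 1"] by (auto simp: uminus_power_if)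
  ultimately show ?thesis
    using sym_sum_eq[OF w T]
    by (simp add: prod_gauss_sums_even[OF w] G_square w.mult w.power power_divide power_mult_distrib)
qed

lemma sym_sum_odd:
  assumes w: "mult_character \<omega>" and T: "T \<in> sym_mats (2 * m + 1)" "det T \<noteq> 0"
  shows "sym_sum (2 * m + 1) \<omega> \<psi> T
    = of_nat CARD('a) ^ (m * (m + 1)) / \<omega> (4 ^ m * det T)
      * gauss_sum \<omega> \<psi> * gauss_sum (\<lambda>a. \<omega> a ^ 2) \<psi> ^ m"
proof -
  interpret w: mult_char \<omega> by unfold_locales fact
  have chi: "\<omega> a * \<chi> a ^ (2 * m) = \<omega> a" for a
    using square[of a] by (cases "a = 0") (simp_all add: power_mult)
  have "(G ^ 2) ^ (m ^ 2) * G ^ (2 * m) = (G ^ 2) ^ (m ^ 2 + m)"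
    by (simp only: power_mult power_add)
  also have "m ^ 2 + m = m * (m + 1)"
    by (simp add: power2_eq_square)
  also have "(G ^ 2) ^ (m * (m + 1)) = of_nat CARD('a) ^ (m * (m + 1))"
    using value_cases[of "- 1"] by (auto simp: G_square uminus_power_if power_mult_distrib)
  finally have powers: "(G ^ 2) ^ (m ^ 2) * G ^ (2 * m) = of_nat CARD('a) ^ (m * (m + 1))" .
  have "(\<Prod>k<2 * m + 1. gauss_sum (\<lambda>a. \<omega> a * \<chi> a ^ k) \<psi> * G ^ k)
      = (\<Prod>k<2 * m. gauss_sum (\<lambda>a. \<omega> a * \<chi> a ^ k) \<psi> * G ^ k) * (gauss_sum \<omega> \<psi> * G ^ (2 * m))"
    by (simp only: Suc_eq_plus1[symmetric] prod.lessThan_Suc chi)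
  also have "\<dots> = (gauss_sum (\<lambda>a. \<omega> a ^ 2) \<psi> / \<omega> 4) ^ m * gauss_sum \<omega> \<psi>
      * ((G ^ 2) ^ (m ^ 2) * G ^ (2 * m))"
    unfolding prod_gauss_sums_even[OF w] by (simp only: mult_ac)
  finally have "(\<Prod>k<2 * m + 1. gauss_sum (\<lambda>a. \<omega> a * \<chi> a ^ k) \<psi> * G ^ k)
      = gauss_sum (\<lambda>a. \<omega> a ^ 2) \<psi> ^ m / \<omega> 4 ^ m * gauss_sum \<omega> \<psi> * of_nat CARD('a) ^ (m * (m + 1))"
    by (simp only: powers power_divide)
  moreover have "\<chi> (det T) ^ Suc (2 * m + 1) = 1"
  proof -
    have "Suc (2 * m + 1) = 2 * Suc m" by simp
    then show ?thesis
      using square[OF T(2)] by (simp only: power_mult power_one)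
  qed
  ultimately show ?thesis
    using sym_sum_eq[OF w T] by (simp add: w.mult w.power mult_ac)
qed

end

section \<open>Character sums of determinants\<close>

definition det_sum :: "nat \<Rightarrow> ('a::{field,finite} \<Rightarrow> complex) \<Rightarrow> complex" where
  "det_sum n \<omega> = (\<Sum>A\<in>sym_mats n. \<omega> (det A))"

lemma sym_sum_trivial: "sym_sum n \<omega> trivial_add_character T = det_sum n \<omega>"
  by (simp add: sym_sum_def det_sum_def trivial_add_character_def)

abbreviation unit_column :: "nat \<Rightarrow> 'a::field mat" where
  "unit_column n \<equiv> mat (Suc n) 1 (\<lambda>(i, _). if i = 0 then 1 else 0)"

lemma mult_unit_column:
  assumes "P \<in> carrier_mat m (Suc n)"
  shows "P * unit_column n = mat m 1 (\<lambda>(i, _). P $$ (i, 0))"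
  using assms
  by (intro eq_matI) (auto simp: scalar_prod_def if_distrib cong: if_cong)

text \<open>If the first entry of \<open>v\<close> is nonzero, replacing the first column of the identity matrix by \<open>v\<close>
  gives an invertible matrix. Otherwise a row addition first makes that entry nonzero.\<close>
lemma extend_nonzero_column:
  fixes v :: "'a::field mat"
  assumes v: "v \<in> carrier_mat (Suc n) 1" "v \<noteq> 0\<^sub>m (Suc n) 1"
  obtains P where "P \<in> carrier_mat (Suc n) (Suc n)" "det P \<noteq> 0" "P * unit_column n = v"
proof -
  have corner: "\<exists>P\<in>carrier_mat (Suc n) (Suc n). det P \<noteq> 0 \<and> P * unit_column n = v"
    if v: "v \<in> carrier_mat (Suc n) 1" and v0: "v $$ (0, 0) \<noteq> 0" for v :: "'a mat"
  proof
    define P where "P = mat (Suc n) (Suc n)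
      (\<lambda>(i, j). if j = 0 then v $$ (i, 0) else if i = j then 1 else 0)"
    show P: "P \<in> carrier_mat (Suc n) (Suc n)" by (simp add: P_def)
    have "det P = prod_list (diag_mat P)"
      by (rule det_lower_triangular[OF _ P]) (auto simp: P_def)
    also have "\<dots> \<noteq> 0"
      using v0 by (auto simp: prod_list_zero_iff diag_mat_def P_def split: if_splits)
    finally show "det P \<noteq> 0 \<and> P * unit_column n = v"
      unfolding mult_unit_column[OF P] using v by (auto simp: P_def intro!: eq_matI)
  qed
  show ?thesis
  proof (cases "v $$ (0, 0) = 0")
    case False
    then show ?thesis using corner v(1) that by blast
  next
    case True
    obtain j where j: "j < Suc n" "v $$ (j, 0) \<noteq> 0"
      by (rule nonzero_column_entry[OF v])
    have "j \<noteq> 0"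
      using j(2) True by metis
    obtain P where P: "P \<in> carrier_mat (Suc n) (Suc n)" "det P \<noteq> 0"
      "P * unit_column n = addrow 1 0 j v"
      using corner[of "addrow 1 0 j v"] v j True by auto
    let ?R = "addrow_mat (Suc n) (- 1) 0 j :: 'a mat"
    have R: "?R \<in> carrier_mat (Suc n) (Suc n)" by simp
    have "?R * P * unit_column n = ?R * (P * unit_column n)"
      by (rule assoc_mult_mat[OF R P(1), of _ 1]) simp
    also have "\<dots> = ?R * addrow 1 0 j v"
      by (simp only: P(3))
    also have "\<dots> = addrow (- 1) 0 j (addrow 1 0 j v)"
      using v j by (intro addrow_mat[symmetric, of _ _ 1]) auto
    also have "\<dots> = v"
      using v j \<open>j \<noteq> 0\<close> by (intro eq_matI) auto
    finally have "?R * P * unit_column n = v" .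
    moreover have "det (?R * P) \<noteq> 0"
      using det_mult[OF R P(1)] det_addrow_mat[of 0 j "Suc n" "- 1 :: 'a"] \<open>j \<noteq> 0\<close> P(2) by simp
    ultimately show ?thesis
      using that[of "?R * P"] R P(1) by simp
  qed
qed

lemma det_bordered_congruence:
  fixes P :: "'a::idom mat"
  assumes P: "P \<in> carrier_mat n n" and v: "v \<in> carrier_mat n 1" and B: "B \<in> carrier_mat n n"
  shows "det (bordered a (P * v) (P * B * transpose_mat P)) = det P ^ 2 * det (bordered a v B)"
proof -
  let ?D = "four_block_mat (1\<^sub>m 1) (0\<^sub>m 1 n) (0\<^sub>m n 1) P"
  have D: "?D \<in> carrier_mat (Suc n) (Suc n)"
    using four_block_carrier_mat[OF one_carrier_mat P, of 1] by simp
  have det_D: "det ?D = det P"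
    using P by (subst det_four_block_mat_upper_right_zero[of _ 1 _ n]) auto
  have Dt: "transpose_mat ?D = four_block_mat (1\<^sub>m 1) (0\<^sub>m 1 n) (0\<^sub>m n 1) (transpose_mat P)"
    using P by (subst transpose_four_block_mat[of _ 1 1 _ n _ n]) auto
  have "?D * bordered a v B
      = four_block_mat (a \<cdot>\<^sub>m 1\<^sub>m 1) (transpose_mat v) (P * v) (P * B)"
    unfolding bordered_def using P v B
    by (subst mult_four_block_mat[of _ 1 1 _ n _ n _ _ 1 _ n]) auto
  also have "\<dots> * transpose_mat ?D
      = four_block_mat (a \<cdot>\<^sub>m 1\<^sub>m 1) (transpose_mat v * transpose_mat P) (P * v) (P * B * transpose_mat P)"
    unfolding Dt using P v B
    by (subst mult_four_block_mat[of _ 1 1 _ n _ n _ _ 1 _ n]) auto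
  also have "transpose_mat v * transpose_mat P = transpose_mat (P * v)"
    using transpose_mult[OF P v] by simp
  finally have "?D * bordered a v B * transpose_mat ?D = bordered a (P * v) (P * B * transpose_mat P)"
    by (simp only: bordered_def)
  then show ?thesis
    using det_congruence[OF D bordered_carrier[OF B], of a v] det_D by simp
qed

text \<open>Swapping the first two rows makes the matrix block triangular with two leading ones.\<close>
lemma det_bordered_unit_column:
  fixes C :: "'a::field mat"
  assumes w: "w \<in> carrier_mat k 1" and C: "C \<in> carrier_mat k k"
  shows "det (bordered 0 (unit_column k) (bordered c w C)) = - det C"
proof -
  let ?M = "bordered 0 (unit_column k) (bordered c w C)"
  let ?D = "four_block_mat (1\<^sub>m 1) (0\<^sub>m 1 k) w C"
  let ?X = "mat 1 (Suc k) (\<lambda>(_, j). if j = 0 then c else w $$ (j - 1, 0))"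
  have M: "?M \<in> carrier_mat (Suc (Suc k)) (Suc (Suc k))"
    using C by simp
  have D: "?D \<in> carrier_mat (Suc k) (Suc k)"
    using four_block_carrier_mat[OF one_carrier_mat C, of 1] by simp
  have "swaprows 0 1 ?M = four_block_mat (1\<^sub>m 1) ?X (0\<^sub>m (Suc k) 1) ?D"
    using w C M D
    by (intro eq_matI) (auto simp: bordered_def)
  moreover have "det (four_block_mat (1\<^sub>m 1) ?X (0\<^sub>m (Suc k) 1) ?D) = det ?D"
    using D by (subst det_four_block_mat_lower_left_zero[of _ 1 _ "Suc k"]) auto
  moreover have "det ?D = det C"
    using w C by (subst det_four_block_mat_upper_right_zero[of _ 1 _ k]) auto
  ultimately show ?thesis
    using det_swaprows[of 0 "Suc (Suc k)" 1 ?M] M by simp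
qed

context mult_char
begin

lemma det_sum_0 [simp]: "det_sum 0 \<omega> = 1"
  by (simp add: det_sum_def sum_sym_mats_0)

lemma det_sum_1: "det_sum 1 \<omega> = (\<Sum>a\<in>UNIV. \<omega> a)"
proof -
  have "carrier_mat 0 1 = {0\<^sub>m 0 1 :: 'a mat}" by (auto intro!: eq_matI)
  then show ?thesis
    unfolding det_sum_def One_nat_def sum_sym_mats_Suc
    using det_bordered_zero[of "0\<^sub>m 0 0 :: 'a mat" 0]
    by (simp add: sum_sym_mats_0)
qed

lemma sum_bordered_nonzero:
  assumes "a \<noteq> 0" "v \<in> carrier_mat n 1"
  shows "(\<Sum>B\<in>sym_mats n. \<omega> (det (bordered a v B))) = \<omega> a * det_sum n \<omega>"
proof -
  let ?C = "inverse a \<cdot>\<^sub>m (v * transpose_mat v)"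
  have "?C \<in> sym_mats n" using assms by (intro smult_sym outer_sym)
  then have "(\<Sum>B\<in>sym_mats n. \<omega> (det (bordered a v B)))
      = (\<Sum>B\<in>sym_mats n. \<omega> (det (bordered a v (B + ?C))))"
    by (rule sum_sym_mats_translate[symmetric])
  also have "\<dots> = (\<Sum>B\<in>sym_mats n. \<omega> a * \<omega> (det B))"
    using assms det_bordered_add_outer[of a v n] by (intro sum.cong) (auto simp: mult)
  finally show ?thesis
    by (simp add: det_sum_def sum_distrib_left)
qed

text \<open>Congruence by \<open>1 \<oplus> P\<close>, where \<open>P\<close> maps the unit column to \<open>v\<close>, multiplies the determinant by
  the square \<open>(det P)\<^sup>2\<close>, which \<open>\<omega>\<close> does not see. For the unit column the value depends only on
  the lower right block, so the \<open>k + 1\<close> entries in the first row of \<open>B\<close> are free.\<close>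
lemma sum_bordered_zero:
  assumes square: "\<And>a. a \<noteq> 0 \<Longrightarrow> \<omega> a ^ 2 = 1"
    and v: "v \<in> carrier_mat (Suc k) 1" "v \<noteq> 0\<^sub>m (Suc k) 1"
  shows "(\<Sum>B\<in>sym_mats (Suc k). \<omega> (det (bordered 0 v B)))
    = of_nat CARD('a) ^ Suc k * \<omega> (- 1) * det_sum k \<omega>"
proof -
  obtain P where P: "P \<in> carrier_mat (Suc k) (Suc k)" "det P \<noteq> 0" "P * unit_column k = v"
    by (rule extend_nonzero_column[OF v])
  have "(\<Sum>B\<in>sym_mats (Suc k). \<omega> (det (bordered 0 v B)))
      = (\<Sum>B\<in>sym_mats (Suc k). \<omega> (det (bordered 0 v (P * B * transpose_mat P))))"
    by (rule sum.reindex_bij_betw[symmetric, OF bij_betw_congruence[OF P(1,2)]])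
  also have "\<dots> = (\<Sum>B\<in>sym_mats (Suc k). \<omega> (det (bordered 0 (unit_column k) B)))"
  proof (intro sum.cong refl)
    fix B :: "'a mat" assume "B \<in> sym_mats (Suc k)"
    then have B: "B \<in> carrier_mat (Suc k) (Suc k)" by auto
    have "det (bordered 0 (P * unit_column k) (P * B * transpose_mat P))
        = det P ^ 2 * det (bordered 0 (unit_column k) B)"
      by (rule det_bordered_congruence[OF P(1) _ B]) simp
    then show "\<omega> (det (bordered 0 v (P * B * transpose_mat P)))
        = \<omega> (det (bordered 0 (unit_column k) B))"
      unfolding P(3) using square[OF P(2)] by (simp add: mult power)
  qed
  also have "\<dots> = (\<Sum>c\<in>(UNIV :: 'a set). \<Sum>w\<in>(carrier_mat k 1 :: 'a mat set). \<Sum>C\<in>sym_mats k. \<omega> (- 1) * \<omega> (det C))"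
    unfolding sum_sym_mats_Suc
  proof (intro sum.cong refl)
    fix c and w C :: "'a mat" assume "w \<in> carrier_mat k 1" "C \<in> sym_mats k"
    then show "\<omega> (det (bordered 0 (unit_column k) (bordered c w C))) = \<omega> (- 1) * \<omega> (det C)"
      using det_bordered_unit_column[of w k C c] mult[of "- 1" "det C"] sym_mats_carrier[of C k] by simp
  qed
  also have "\<dots> = of_nat CARD('a) * (of_nat CARD('a) ^ k * (\<omega> (- 1) * det_sum k \<omega>))"
    by (simp add: det_sum_def card_carrier_mat flip: sum_distrib_left)
  finally show ?thesis by simp
qed

text \<open>The first term collects the corners \<open>a \<noteq> 0\<close>, with \<open>q ^ (k + 1)\<close> choices of border each, and the
  second one the corner 0 with its nonzero borders.\<close>
lemma det_sum_Suc_Suc: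
  assumes square: "\<And>a. a \<noteq> 0 \<Longrightarrow> \<omega> a ^ 2 = 1"
  shows "det_sum (Suc (Suc k)) \<omega>
    = (\<Sum>a\<in>UNIV. \<omega> a) * of_nat CARD('a) ^ Suc k * det_sum (Suc k) \<omega>
      + (of_nat CARD('a) ^ Suc k - 1) * of_nat CARD('a) ^ Suc k * \<omega> (- 1) * det_sum k \<omega>"
proof -
  let ?V = "carrier_mat (Suc k) 1 :: 'a mat set"
  let ?q = "of_nat CARD('a) :: complex"
  let ?F = "\<lambda>a v. \<Sum>B\<in>sym_mats (Suc k). \<omega> (det (bordered a v B))"
  have V: "finite ?V" "card ?V = CARD('a) ^ Suc k" "0\<^sub>m (Suc k) 1 \<in> ?V"
    using finite_carrier_mat card_carrier_mat[of "Suc k" 1] by auto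
  have "\<omega> (det (bordered 0 (0\<^sub>m (Suc k) 1) B)) = 0" if "B \<in> sym_mats (Suc k)" for B :: "'a mat"
    using det_bordered_zero[of B "Suc k" 0] that by auto
  then have "?F 0 (0\<^sub>m (Suc k) 1) = 0"
    by simp
  then have "(\<Sum>v\<in>?V. ?F 0 v) = (\<Sum>v\<in>?V - {0\<^sub>m (Suc k) 1}. ?F 0 v)"
    using sum.remove[OF V(1,3), of "?F 0"] by simp
  also have "\<dots> = (\<Sum>v\<in>?V - {0\<^sub>m (Suc k) 1}. ?q ^ Suc k * \<omega> (- 1) * det_sum k \<omega>)"
    by (intro sum.cong refl sum_bordered_zero square) auto
  also have "\<dots> = (?q ^ Suc k - 1) * ?q ^ Suc k * \<omega> (- 1) * det_sum k \<omega>"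
  proof -
    have "card (?V - {0\<^sub>m (Suc k) 1}) = CARD('a) ^ Suc k - 1"
      using V by simp
    moreover have "of_nat (CARD('a) ^ Suc k - 1) = ?q ^ Suc k - 1"
      by (simp add: of_nat_diff)
    ultimately show ?thesis
      by (simp only: sum_constant mult.assoc)
  qed
  finally have zero: "(\<Sum>v\<in>?V. ?F 0 v) = (?q ^ Suc k - 1) * ?q ^ Suc k * \<omega> (- 1) * det_sum k \<omega>" .
  have "(\<Sum>a\<in>UNIV - {0}. \<Sum>v\<in>?V. ?F a v) = (\<Sum>a\<in>UNIV - {0}. ?q ^ Suc k * (\<omega> a * det_sum (Suc k) \<omega>))"
  proof (intro sum.cong refl)
    fix a :: 'a assume "a \<in> UNIV - {0}"
    then have "(\<Sum>v\<in>?V. ?F a v) = (\<Sum>v\<in>?V. \<omega> a * det_sum (Suc k) \<omega>)"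
      by (intro sum.cong refl sum_bordered_nonzero) auto
    then show "(\<Sum>v\<in>?V. ?F a v) = ?q ^ Suc k * (\<omega> a * det_sum (Suc k) \<omega>)"
      by (simp only: sum_constant V(2) of_nat_power)
  qed
  also have "\<dots> = (\<Sum>a\<in>UNIV. ?q ^ Suc k * (\<omega> a * det_sum (Suc k) \<omega>))"
    by (intro sum.mono_neutral_left) auto
  also have "\<dots> = (\<Sum>a\<in>UNIV. \<omega> a) * ?q ^ Suc k * det_sum (Suc k) \<omega>"
    unfolding sum_distrib_right by (intro sum.cong refl) (simp only: mult_ac)
  finally have nonzero: "(\<Sum>a\<in>UNIV - {0}. \<Sum>v\<in>?V. ?F a v)
      = (\<Sum>a\<in>UNIV. \<omega> a) * ?q ^ Suc k * det_sum (Suc k) \<omega>" .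
  have "det_sum (Suc (Suc k)) \<omega> = (\<Sum>a\<in>UNIV. \<Sum>v\<in>?V. ?F a v)"
    unfolding det_sum_def by (rule sum_sym_mats_Suc)
  also have "\<dots> = (\<Sum>v\<in>?V. ?F 0 v) + (\<Sum>a\<in>UNIV - {0}. \<Sum>v\<in>?V. ?F a v)"
    by (rule sum.remove) auto
  finally show ?thesis
    by (simp only: zero nonzero add.commute)
qed

text \<open>Congruence by a matrix of determinant \<open>c\<close> multiplies the sum by \<open>\<omega> c ^ 2\<close>.\<close>
lemma det_sum_eq_zero_of_square:
  assumes "n > 0" and c: "c \<noteq> 0" "\<omega> c ^ 2 \<noteq> 1"
  shows "det_sum n \<omega> = 0"
proof -
  obtain k where n: "n = Suc k" using assms(1) gr0_implies_Suc by blast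
  let ?P = "bordered c (0\<^sub>m k 1) (1\<^sub>m k)"
  have P: "?P \<in> carrier_mat n n" by (simp add: n)
  have det_P: "det ?P = c" using det_bordered_zero[of "1\<^sub>m k" k c] by simp
  then have P0: "det ?P \<noteq> 0" using c by metis
  have "det_sum n \<omega> = (\<Sum>A\<in>sym_mats n. \<omega> (det (?P * A * transpose_mat ?P)))"
    unfolding det_sum_def by (rule sum.reindex_bij_betw[symmetric, OF bij_betw_congruence[OF P P0]])
  also have "\<dots> = (\<Sum>A\<in>sym_mats n. \<omega> c ^ 2 * \<omega> (det A))"
    using det_congruence[OF P] by (intro sum.cong refl) (auto simp only: det_P mult power dest!: sym_mats_carrier)
  also have "\<dots> = \<omega> c ^ 2 * det_sum n \<omega>"
    by (simp add: det_sum_def sum_distrib_left)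
  finally show ?thesis using c by simp
qed

lemma det_sum_eq_zero_of_scaling:
  assumes c: "c \<noteq> 0" "\<omega> c ^ n \<noteq> 1"
  shows "det_sum n \<omega> = 0"
proof -
  have cancel: "c ^ d * (inverse c ^ d * x) = x" for d x
    using c(1) by (simp add: power_inverse)
  have "det_sum n \<omega> = (\<Sum>A\<in>sym_mats n. \<omega> (det (c \<cdot>\<^sub>m A)))"
    unfolding det_sum_def using c by (intro sum.reindex_bij_witness[of _ "\<lambda>A. c \<cdot>\<^sub>m A" "\<lambda>A. inverse c \<cdot>\<^sub>m A"])
      (auto simp: cancel intro!: smult_sym eq_matI)
  also have "\<dots> = (\<Sum>A\<in>sym_mats n. \<omega> c ^ n * \<omega> (det A))"
  proof (intro sum.cong refl)
    fix A :: "'a mat" assume "A \<in> sym_mats n"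
    then have "dim_col A = n" by auto
    then show "\<omega> (det (c \<cdot>\<^sub>m A)) = \<omega> c ^ n * \<omega> (det A)" by (simp add: mult power)
  qed
  also have "\<dots> = \<omega> c ^ n * det_sum n \<omega>"
    by (simp add: det_sum_def sum_distrib_left)
  finally have "det_sum n \<omega> = \<omega> c ^ n * det_sum n \<omega>" .
  then show ?thesis using c by simp
qed

end

text \<open>Since \<open>\<chi>\<close> sums to zero, only the second term of the recursion survives, and it links sizes of
  equal parity.\<close>
lemma (in quadratic_char) det_sum_even:
  "det_sum (2 * m) \<chi> = \<chi> (- 1) ^ m * of_nat CARD('a) ^ (m\<^sup>2) * (\<Prod>k<m. of_nat CARD('a) ^ (2 * k + 1) - 1)"
proof (induction m)
  case (Suc m)
  let ?q = "of_nat CARD('a) :: complex"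
  have exponent: "(Suc m)\<^sup>2 = (2 * m + 1) + m\<^sup>2"
    by (simp add: power2_eq_square)
  have "det_sum (2 * Suc m) \<chi> = (?q ^ (2 * m + 1) - 1) * ?q ^ (2 * m + 1) * \<chi> (- 1) * det_sum (2 * m) \<chi>"
    using det_sum_Suc_Suc[of "2 * m"] square sum_eq_zero[OF nontrivial] by simp
  then show ?case
    unfolding Suc exponent power_add[of ?q "2 * m + 1"] prod.lessThan_Suc power_Suc[of "\<chi> (- 1)"]
    by (simp only: mult_ac)
qed simp

text \<open>These sums count the invertible symmetric matrices. The recursion links both parities, so the two
  formulas are proved together; besides routine algebra the step uses
  \<open>(q - 1) (q ^ (2 m + 1) - 1) + (q ^ (2 m + 1) - 1) = q (q ^ (2 m + 1) - 1)\<close> for even sizes and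
  \<open>(q - 1) q ^ (2 m + 2) + q ^ (2 m + 2) - 1 = q ^ (2 m + 3) - 1\<close> for odd ones.\<close>
lemma det_sum_trivial:
  defines "q \<equiv> of_nat CARD('a::{field,finite}) :: complex"
  defines "N \<equiv> \<lambda>n. det_sum n (trivial_mult_character :: 'a \<Rightarrow> complex)"
  shows "N (2 * m) = q ^ (m\<^sup>2 + m) * (\<Prod>k<m. q ^ (2 * k + 1) - 1)"
    and "N (2 * m + 1) = q ^ (m\<^sup>2 + m) * (\<Prod>k\<le>m. q ^ (2 * k + 1) - 1)"
proof -
  interpret mult_char "trivial_mult_character :: 'a \<Rightarrow> complex"
    by unfold_locales (auto simp: mult_character_def trivial_mult_character_def)
  have "(\<Sum>a\<in>UNIV. trivial_mult_character (a :: 'a)) = (\<Sum>a\<in>UNIV - {0 :: 'a}. 1)"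
    by (subst sum.remove[of _ 0]) (auto simp: trivial_mult_character_def)
  also have "\<dots> = q - 1"
    by (simp add: q_def card_Diff_singleton of_nat_diff)
  finally have sum: "(\<Sum>a\<in>UNIV. trivial_mult_character (a :: 'a)) = q - 1" .
  have sq: "trivial_mult_character a ^ 2 = 1" if "a \<noteq> 0" for a :: 'a
    using that by (simp add: trivial_mult_character_def)
  have m1: "trivial_mult_character (- 1 :: 'a) = 1"
    by (simp add: trivial_mult_character_def)
  have rec: "N (Suc (Suc k)) = (q - 1) * q ^ Suc k * N (Suc k) + (q ^ Suc k - 1) * q ^ Suc k * N k" for k
    unfolding N_def using det_sum_Suc_Suc[of k, unfolded sum m1 mult_1_right q_def[symmetric]] sq
    by blast
  have "N (2 * m) = q ^ (m\<^sup>2 + m) * (\<Prod>k<m. q ^ (2 * k + 1) - 1)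
    \<and> N (2 * m + 1) = q ^ (m\<^sup>2 + m) * (\<Prod>k\<le>m. q ^ (2 * k + 1) - 1)"
  proof (induction m)
    case 0
    then show ?case using det_sum_1 by (simp add: N_def sum)
  next
    case (Suc m)
    define p where "p = (\<Prod>k<m. q ^ (2 * k + 1) - 1)"
    define x where "x = q ^ (2 * m)"
    define y where "y = q ^ (m\<^sup>2 + m)"
    have le: "(\<Prod>k\<le>m. q ^ (2 * k + 1) - 1) = p * (q * x - 1)"
      by (simp add: p_def x_def flip: lessThan_Suc_atMost)
    have N: "N (2 * m) = y * p" "N (Suc (2 * m)) = y * (p * (q * x - 1))"
      using Suc le by (simp_all add: p_def y_def)
    have exponent: "q ^ ((Suc m)\<^sup>2 + Suc m) = q ^ 2 * x * y"
      unfolding x_def y_def power_add[symmetric]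
      by (rule arg_cong[of _ _ "power q"]) (simp add: power2_eq_square)
    have even: "N (2 * Suc m) = q ^ 2 * x * y * (p * (q * x - 1))"
      using rec[of "2 * m"] by (simp add: N flip: x_def) (simp add: algebra_simps power2_eq_square)
    have odd: "N (Suc (2 * Suc m)) = q ^ 2 * x * y * (p * (q * x - 1) * (q ^ 3 * x - 1))"
      using rec[of "Suc (2 * m)"] even
      by (simp add: N flip: x_def) (simp add: algebra_simps power2_eq_square power3_eq_cube)
    have "q ^ (2 * Suc m + 1) = q ^ 3 * x"
      by (simp add: x_def power3_eq_cube)
    then have "(\<Prod>k\<le>Suc m. q ^ (2 * k + 1) - 1) = p * (q * x - 1) * (q ^ 3 * x - 1)"
      using le by (simp only: prod.atMost_Suc)
    then show ?case
      using even odd le by (simp only: exponent lessThan_Suc_atMost Suc_eq_plus1[symmetric] simp_thms)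
  qed
  then show "N (2 * m) = q ^ (m\<^sup>2 + m) * (\<Prod>k<m. q ^ (2 * k + 1) - 1)"
    and "N (2 * m + 1) = q ^ (m\<^sup>2 + m) * (\<Prod>k\<le>m. q ^ (2 * k + 1) - 1)"
    by simp_all
qed

section \<open>Evaluation of the matrix Gauss sums\<close>

theorem theorem3p3p4:
  fixes q n :: nat
    and \<omega> \<chi> \<psi> :: "'a::{field,finite} \<Rightarrow> complex"
    and T :: "'a mat"
  assumes q: "q = CARD('a)" and "odd q"
    and "mult_character \<omega>"
    and "add_character \<psi>"
    and "nontrivial_quadratic_character \<chi>"
    and "T \<in> invertible_symmetric_mats n"
  shows
    "(\<psi> \<noteq> trivial_add_character \<longrightarrow>
        (\<forall>m. n = 2 * m \<longrightarrow> m > 0 \<longrightarrow>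
           sym_gauss_sum n \<omega> \<psi> T =
             \<chi> (- 1) ^ m * \<chi> (det T) * of_nat q ^ (m\<^sup>2) / \<omega> (4 ^ m * det T)
               * gauss_sum (\<lambda>a. \<omega> a ^ 2) \<psi> ^ m) \<and>
        (\<forall>m. n = 2 * m + 1 \<longrightarrow>
           sym_gauss_sum n \<omega> \<psi> T =
             of_nat q ^ (m * (m + 1)) / \<omega> (4 ^ m * det T)
               * gauss_sum \<omega> \<psi> * gauss_sum (\<lambda>a. \<omega> a ^ 2) \<psi> ^ m))
     \<and>
     (\<psi> = trivial_add_character \<and> \<omega> = \<chi> \<longrightarrow>
        (\<forall>m. n = 2 * m \<longrightarrow>
           sym_gauss_sum n \<omega> \<psi> T =
             \<chi> (- 1) ^ m * of_nat q ^ (m\<^sup>2) * (\<Prod>k<m. of_nat q ^ (2 * k + 1) - 1)))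
     \<and>
     (\<psi> = trivial_add_character \<and> \<omega> = trivial_mult_character \<longrightarrow>
        (\<forall>m. n = 2 * m \<longrightarrow>
           sym_gauss_sum n \<omega> \<psi> T =
             of_nat q ^ (m\<^sup>2 + m) * (\<Prod>k<m. of_nat q ^ (2 * k + 1) - 1)) \<and>
        (\<forall>m. n = 2 * m + 1 \<longrightarrow>
           sym_gauss_sum n \<omega> \<psi> T =
             of_nat q ^ (m\<^sup>2 + m) * (\<Prod>k\<le>m. of_nat q ^ (2 * k + 1) - 1)))
     \<and>
     (\<psi> = trivial_add_character \<and>
        (\<omega> \<notin> {trivial_mult_character, \<chi>} \<or> \<omega> = \<chi> \<and> odd n) \<and> n > 0 \<longrightarrow>
        sym_gauss_sum n \<omega> \<psi> T = 0)"
proof -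
  have two: "(2::'a) \<noteq> 0"
    using two_nonzero_of_odd_card assms(1,2) by simp
  interpret w: mult_char \<omega> by unfold_locales fact
  have quadratic: "quadratic_char \<theta>"
    if "nontrivial_quadratic_character \<theta>" for \<theta> :: "'a \<Rightarrow> complex"
  proof unfold_locales
    show "\<theta> a ^ 2 = 1" if "a \<noteq> 0" for a
      using \<open>nontrivial_quadratic_character \<theta>\<close> that
      by (auto simp: nontrivial_quadratic_character_def trivial_mult_character_def fun_eq_iff)
  qed (use that two in \<open>auto simp: nontrivial_quadratic_character_def\<close>)
  interpret x: quadratic_char \<chi>
    using quadratic assms(5) .
  have T: "T \<in> sym_mats n" "det T \<noteq> 0"
    using assms(6) by (auto simp: invertible_symmetric_mats_eq)
  have a: "sym_sum n \<omega> \<psi> T =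
        \<chi> (- 1) ^ m * \<chi> (det T) * of_nat q ^ (m\<^sup>2) / \<omega> (4 ^ m * det T)
          * gauss_sum (\<lambda>a. \<omega> a ^ 2) \<psi> ^ m" if "n = 2 * m" "\<psi> \<noteq> trivial_add_character" for m
  proof -
    interpret quadratic_gauss \<chi> \<psi> by unfold_locales (use assms that in auto)
    show ?thesis using sym_sum_even[OF assms(3)] T that q by simp
  qed
  have a': "sym_sum n \<omega> \<psi> T =
        of_nat q ^ (m * (m + 1)) / \<omega> (4 ^ m * det T)
          * gauss_sum \<omega> \<psi> * gauss_sum (\<lambda>a. \<omega> a ^ 2) \<psi> ^ m"
    if "n = 2 * m + 1" "\<psi> \<noteq> trivial_add_character" for m
  proof -
    interpret quadratic_gauss \<chi> \<psi> by unfold_locales (use assms that in auto)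
    show ?thesis using sym_sum_odd[OF assms(3)] T that q by simp
  qed
  have d: "det_sum n \<omega> = 0" if "\<omega> \<notin> {trivial_mult_character, \<chi>}" "n > 0"
  proof -
    have "\<exists>c. c \<noteq> 0 \<and> \<omega> c ^ 2 \<noteq> 1"
    proof (rule ccontr)
      assume "\<nexists>c. c \<noteq> 0 \<and> \<omega> c ^ 2 \<noteq> 1"
      then have "quadratic_char \<omega>"
        using that two by unfold_locales auto
      then show False
        using quadratic_char_unique x.quadratic_char_axioms that by blast
    qed
    then show ?thesis
      using w.det_sum_eq_zero_of_square that(2) by blast
  qed
  have d': "det_sum n \<chi> = 0" if "odd n"
  proof -
    have "\<exists>c. c \<noteq> 0 \<and> \<chi> c \<noteq> 1"
    proof (rule ccontr)
      assume "\<nexists>c. c \<noteq> 0 \<and> \<chi> c \<noteq> 1"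
      then have "\<chi> = trivial_mult_character"
        by (auto simp: fun_eq_iff trivial_mult_character_def)
      then show False using x.nontrivial by simp
    qed
    then obtain c where c: "c \<noteq> 0" "\<chi> c \<noteq> 1" by blast
    then have "\<chi> c ^ n \<noteq> 1"
      using x.value_cases[OF c(1)] that by auto
    then show ?thesis
      using x.det_sum_eq_zero_of_scaling c(1) by blast
  qed
  have trivial: "sym_sum n \<omega> \<psi> T = det_sum n \<omega>" if "\<psi> = trivial_add_character"
    using that by (simp add: sym_sum_trivial)
  have b: "sym_sum n \<omega> \<psi> T
      = \<chi> (- 1) ^ m * of_nat q ^ (m\<^sup>2) * (\<Prod>k<m. of_nat q ^ (2 * k + 1) - 1)"
    if "\<psi> = trivial_add_character" "\<omega> = \<chi>" "n = 2 * m" for m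
    unfolding trivial[OF that(1)] unfolding that(2,3) q by (rule x.det_sum_even)
  have c: "sym_sum n \<omega> \<psi> T = of_nat q ^ (m\<^sup>2 + m) * (\<Prod>k<m. of_nat q ^ (2 * k + 1) - 1)"
    if "\<psi> = trivial_add_character" "\<omega> = trivial_mult_character" "n = 2 * m" for m
    unfolding trivial[OF that(1)] unfolding that(2,3) q by (rule det_sum_trivial)
  have c': "sym_sum n \<omega> \<psi> T = of_nat q ^ (m\<^sup>2 + m) * (\<Prod>k\<le>m. of_nat q ^ (2 * k + 1) - 1)"
    if "\<psi> = trivial_add_character" "\<omega> = trivial_mult_character" "n = 2 * m + 1" for m
    unfolding trivial[OF that(1)] unfolding that(2,3) q by (rule det_sum_trivial)
  have "sym_sum n \<omega> \<psi> T = 0"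
    if "\<psi> = trivial_add_character" "\<omega> \<notin> {trivial_mult_character, \<chi>} \<or> \<omega> = \<chi> \<and> odd n" "n > 0"
    using trivial[OF that(1)] that(2,3) d d' by metis
  with a a' b c c' show ?thesis
    unfolding w.sym_gauss_sum_eq by blast
qed

end
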